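(* Let $g>1$ be an integer and let $c_1, \ldots, c_g$ be nonnegative integers (not necessarily distinct). Let $h$ be an integer with $1 \le h < g$ and let $d_1, \ldots, d_h$ be positive integers (not necessarily distinct). Then there exists a positive integer $N$ such that, for all integers $n \ge N$, $$p_{n-c_1}+p_{n-c_2}+\cdots+p_{n-c_g} > p_{n+d_1}+\cdots+p_{n+d_h}.$$
   Context: For each integer $n \ge 1$, $p_n$ denotes the $n$th prime number, so $p_1=2$, $p_2=3$, $p_3=5$, and so on. The symbol $p_m$ is defined only for $m \ge 1$; the assertion for all $n\ge N$ includes that all indices $n-c_i$ are at least $1$. *)

theory Defs
  imports "HOL-Computational_Algebra.Primes" "HOL-Library.Infinite_Set"
begin

text \<open>
  The library's \<open>enumerate\<close> lists the primes in increasing order starting from index 0, so the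
  index is shifted to make 2 the prime with index 1. Because subtraction is truncated, the value
  at index 0 is meaningless; the indices that occur must be constrained to be at least 1.
\<close>

definition nth_prime :: "nat \<Rightarrow> nat" where
  "nth_prime n = enumerate {p. prime p} (n - 1)"

lemma prime_nth_prime: "prime (nth_prime n)"
  using enumerate_in_set[OF primes_infinite, of "n - 1"] by (simp add: nth_prime_def)

lemma strict_mono_on_nth_prime: "strict_mono_on {1..} nth_prime"
proof (rule strict_mono_onI)
  fix m n :: nat
  assume "m \<in> {1..}" "n \<in> {1..}" "m < n"
  then have "m - 1 < n - 1"
    by simp
  then show "nth_prime m < nth_prime n"
    unfolding nth_prime_def by (rule enumerate_mono[OF _ primes_infinite])
qed

lemma nth_prime_image: "nth_prime ` {1..} = {p. prime p}"
proof
  show "nth_prime ` {1..} \<subseteq> {p. prime p}"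
    using prime_nth_prime by auto
  show "{p. prime p} \<subseteq> nth_prime ` {1..}"
  proof
    fix p :: nat
    assume "p \<in> {p. prime p}"
    then obtain m where "enumerate {p. prime p} m = p"
      using enumerate_Ex[OF primes_infinite] by blast
    then have "p = nth_prime (Suc m)"
      by (simp add: nth_prime_def)
    then show "p \<in> nth_prime ` {1..}"
      by (rule image_eqI) simp
  qed
qed

end

theory Submission
  imports Defs "HOL-Complex_Analysis.Complex_Analysis" "HOL-Number_Theory.Prime_Powers"
    "HOL-Real_Asymp.Real_Asymp"
begin

text \<open>
  It suffices that \<open>p\<^sub>n\<^sub>+\<^sub>1 / p\<^sub>n\<close> tends to 1, since then \<open>p\<^sub>n\<^sub>+\<^sub>D \<le> (1 + \<epsilon>) p\<^sub>n\<^sub>-\<^sub>C\<close> eventually,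
  for all \<open>C\<close>, \<open>D\<close> and \<open>\<epsilon> > 0\<close>. This is proved by a quantitative variant of the Wiener--Ikehara
  argument. Let \<open>F(s)\<close> be the Dirichlet series of the von Mangoldt function \<open>\<Lambda>\<close>. As \<open>\<zeta>\<close> has no
  zeros on the line \<open>Re s = 1\<close>, the difference \<open>F - \<zeta>\<close> is holomorphic on a neighbourhood of
  \<open>Re s \<ge> 1\<close>. Integrating it against \<open>(1 - u) e\<^sup>i\<^sup>u\<^sup>T\<^sup>y\<close> over \<open>s = 1 + \<delta> + iuT\<close>, \<open>0 \<le> u \<le> 1\<close>, and
  integrating by parts shows that the sums of \<open>\<Lambda>(n) n\<^sup>-\<^sup>1\<^sup>-\<^sup>\<delta> K(T (y - ln n))\<close> and of
  \<open>n\<^sup>-\<^sup>1\<^sup>-\<^sup>\<delta> K(T (y - ln n))\<close>, with the Fejer kernel \<open>K\<close>, differ by \<open>O(1 / y)\<close> uniformly in \<open>\<delta>\<close>.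
  The second sum is at least of order \<open>1 / T\<close>, whereas the terms with \<open>\<bar>y - ln n\<bar> > \<eta>\<close> contribute
  only \<open>O(1 / T\<^sup>2)\<close> to the first. So for large \<open>T\<close> and then large \<open>y\<close> there is mass of \<open>\<Lambda>\<close> within
  \<open>\<bar>y - ln n\<bar> \<le> \<eta>\<close>, more than the proper prime powers can account for. Taking \<open>\<delta> = 1 / y\<close> avoids
  passing to the limit in \<open>\<delta>\<close>.
\<close>

section \<open>The Fejer kernel\<close>

text \<open>The value at 0 is the continuous extension. With it the kernel is everywhere the cosine
  transform of \<open>1 - u\<close> on \<open>{0..1}\<close>.\<close>

definition fejer :: "real \<Rightarrow> real" where
  "fejer v = (if v = 0 then 1 / 2 else (1 - cos v) / v\<^sup>2)"

lemma fejer_has_integral: "((\<lambda>u. (1 - u) * cos (u * v)) has_integral fejer v) {0..1}"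
proof (cases "v = 0")
  case True
  have "((\<lambda>u. 1 - u) has_integral (1 - 1\<^sup>2 / 2) - (0 - 0\<^sup>2 / 2)) {0..1::real}"
    by (rule fundamental_theorem_of_calculus)
       (auto intro!: derivative_eq_intros simp flip: has_real_derivative_iff_has_vector_derivative)
  then show ?thesis
    using True by (simp add: fejer_def)
next
  case False
  let ?F = "\<lambda>u. (1 - u) * sin (u * v) / v - cos (u * v) / v\<^sup>2"
  have "((\<lambda>u. (1 - u) * cos (u * v)) has_integral ?F 1 - ?F 0) {0..1}"
    by (rule fundamental_theorem_of_calculus)
       (use False in \<open>auto intro!: derivative_eq_intros
          simp: field_simps power2_eq_square simp flip: has_real_derivative_iff_has_vector_derivative\<close>)
  then show ?thesis
    using False by (simp add: fejer_def diff_divide_distrib)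
qed

lemma fejer_nonneg: "fejer v \<ge> 0"
  by (simp add: fejer_def)

lemma fejer_le_half: "fejer v \<le> 1 / 2"
proof (cases "v = 0")
  case False
  have "(sin (v / 2))\<^sup>2 \<le> (v / 2)\<^sup>2"
    by (metis abs_sin_x_le_abs_x power2_abs power_mono abs_ge_zero)
  moreover have "1 - cos v = 2 * (sin (v / 2))\<^sup>2"
    using cos_double_sin[of "v / 2"] by simp
  ultimately have "1 - cos v \<le> v\<^sup>2 / 2"
    by (simp add: power_divide)
  then have "(1 - cos v) / v\<^sup>2 \<le> (v\<^sup>2 / 2) / v\<^sup>2"
    by (rule divide_right_mono) simp
  then show ?thesis
    using False by (simp add: fejer_def)
qed (simp add: fejer_def)

lemma fejer_le_inverse_square: "v \<noteq> 0 \<Longrightarrow> fejer v \<le> 2 / v\<^sup>2"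
  using cos_ge_minus_one[of v] by (auto simp: fejer_def intro!: divide_right_mono)

lemma fejer_le_cauchy: "fejer v \<le> 3 / (1 + v\<^sup>2)"
\<comment> \<open>Any threshold from 2 to 5 would do: the bound \<open>1 / 2\<close> suffices while
  \<open>v\<^sup>2 \<le> 5\<close>, the bound \<open>2 / v\<^sup>2\<close> as soon as
  \<open>v\<^sup>2 \<ge> 2\<close>.\<close>
proof (cases "v\<^sup>2 \<le> 3")
  case True
  then have "1 / 2 \<le> 3 / (1 + v\<^sup>2)"
    by (simp add: field_simps add_pos_nonneg)
  then show ?thesis
    using fejer_le_half[of v] by linarith
next
  case False
  then have "v \<noteq> 0"
    by auto
  then have "fejer v \<le> 2 / v\<^sup>2"
    by (rule fejer_le_inverse_square)
  also have "\<dots> \<le> 3 / (1 + v\<^sup>2)"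
    using False by (subst frac_le_eq) (auto simp: add_nonneg_eq_0_iff intro!: divide_nonpos_pos mult_pos_pos)
  finally show ?thesis .
qed

text \<open>Since \<open>1 < pi / 3\<close>, every cosine under the integral is at least
  \<open>1 / 2\<close>, so the integral is at least half of its value at
  \<open>v = 0\<close>.\<close>

lemma fejer_ge_quarter:
  assumes "\<bar>v\<bar> \<le> 1"
  shows "fejer v \<ge> 1 / 4"
proof -
  have *: "((\<lambda>u. (1 / 2) * ((1 - u) * cos (u * 0))) has_integral (1 / 2) * fejer 0) {0..1}"
    by (rule has_integral_mult_right[OF fejer_has_integral])
  have "(1 / 2) * ((1 - u) * cos (u * 0)) \<le> (1 - u) * cos (u * v)" if u: "u \<in> {0..1}" for u
  proof -
    have "\<bar>u * v\<bar> \<le> 1"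
      using u assms by (simp add: abs_mult mult_le_one)
    then have "cos \<bar>u * v\<bar> \<ge> cos (pi / 3)"
      using pi_gt3 by (intro cos_monotone_0_pi_le) auto
    then have "cos (u * v) \<ge> 1 / 2"
      by (simp add: cos_60)
    then show ?thesis
      using u mult_left_mono[of "1 / 2" "cos (u * v)" "1 - u"] by simp
  qed
  from has_integral_le[OF * fejer_has_integral this] show ?thesis
    by (simp add: fejer_def)
qed

text \<open>The zeros \<open>2\<pi>k\<close> of the kernel are filled in by a translate, because
  \<open>(1 - cos v) + (1 - cos (v + \<pi>)) = 2\<close>.\<close>

lemma fejer_shift_ge: "fejer v + fejer (v + pi) \<ge> 1 / (20 * (1 + v\<^sup>2))"
proof -
  \<comment> \<open>One denominator dominating both \<open>v\<^sup>2\<close> and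
    \<open>(v + pi)\<^sup>2\<close>; over it the numerators \<open>1 - cos v\<close> and
    \<open>1 + cos v\<close> add up to 2.\<close>
  define D where "D = 40 * (1 + v\<^sup>2)"
  have small: "1 / (20 * (1 + v\<^sup>2)) \<le> 1 / 2"
    by (simp add: field_simps add_pos_nonneg)
  consider "v = 0" | "v + pi = 0" | "v \<noteq> 0" "v + pi \<noteq> 0"
    by blast
  then show ?thesis
  proof cases
    case 1
    then show ?thesis
      using fejer_nonneg[of "v + pi"] small by (simp add: fejer_def)
  next
    case 2
    then have "fejer (v + pi) = 1 / 2"
      by (simp add: fejer_def)
    then show ?thesis
      using fejer_nonneg[of v] small by linarith
  next
    case 3
    have "pi * pi \<le> 4 * 4"
      using pi_less_4 by (intro mult_mono) auto
    moreover have "(v + pi)\<^sup>2 + (v - pi)\<^sup>2 = 2 * v\<^sup>2 + 2 * (pi * pi)"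
      by (simp add: power2_eq_square algebra_simps)
    ultimately have "(v + pi)\<^sup>2 \<le> 2 * v\<^sup>2 + 32"
      using zero_le_power2[of "v - pi"] by linarith
    moreover have v2: "v\<^sup>2 \<ge> 0"
      by simp
    ultimately have D: "v\<^sup>2 \<le> D" "(v + pi)\<^sup>2 \<le> D" "D > 0"
      using v2 unfolding D_def distrib_left by linarith+
    have "(1 - cos v) / D \<le> (1 - cos v) / v\<^sup>2"
      using 3 D by (intro divide_left_mono) auto
    moreover have "0 \<le> 1 + cos v"
      using cos_ge_minus_one[of v] by linarith
    then have "(1 + cos v) / D \<le> (1 + cos v) / (v + pi)\<^sup>2"
      using 3 D by (intro divide_left_mono mult_pos_pos) auto
    moreover have "(1 - cos v) / D + (1 + cos v) / D = 2 / D"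
      by (simp flip: add_divide_distrib)
    moreover have "2 / (40 * x) = 1 / (20 * x)" for x :: real
      by simp
    then have "2 / D = 1 / (20 * (1 + v\<^sup>2))"
      unfolding D_def .
    ultimately show ?thesis
      using 3 by (simp add: fejer_def)
  qed
qed

section \<open>Oscillatory integrals and kernel-weighted Dirichlet series\<close>

text \<open>Integration by parts against an antiderivative of the oscillating factor, of modulus
  \<open>1 / \<omega>\<close>: the two boundary terms and the remaining integral cost at most
  \<open>M / \<omega>\<close> each.\<close>

lemma norm_integral_mult_cis_le:
  fixes f f' :: "real \<Rightarrow> complex"
  assumes \<omega>: "\<omega> > 0"
    and f': "\<And>u. u \<in> {0..1} \<Longrightarrow> (f has_vector_derivative f' u) (at u within {0..1})"
    and bound: "\<And>u. u \<in> {0..1} \<Longrightarrow> norm (f u) \<le> M" "\<And>u. u \<in> {0..1} \<Longrightarrow> norm (f' u) \<le> M"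
  shows "norm (integral {0..1} (\<lambda>u. f u * cis (\<omega> * u))) \<le> 3 * M / \<omega>"
proof -
  define e where "e u = cis (\<omega> * u) / (\<i> * \<omega>)" for u
  have e: "(e has_vector_derivative cis (\<omega> * u)) (at u within {0..1})" for u
    unfolding e_def cis_conv_exp using \<omega>
    by (auto intro!: derivative_eq_intros has_vector_derivative_real_field simp: field_simps)
  have norm_e: "norm (e u) = 1 / \<omega>" for u
    using \<omega> by (simp add: e_def norm_divide norm_mult)
  have parts: "((\<lambda>u. f u * cis (\<omega> * u) + f' u * e u) has_integral f 1 * e 1 - f 0 * e 0) {0..1}"
    by (rule fundamental_theorem_of_calculus)
       (auto intro!: has_vector_derivative_mult f' e)
  have "continuous_on {0..1} f"
    using f' has_vector_derivative_continuous continuous_on_eq_continuous_within by blast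
  then have "(\<lambda>u. f u * cis (\<omega> * u)) integrable_on {0..1}"
    by (intro integrable_continuous_real continuous_intros)
  then obtain I where I: "((\<lambda>u. f u * cis (\<omega> * u)) has_integral I) {0..1}"
    by blast
  \<comment> \<open>Only pointwise information on \<open>f'\<close> is available, so this product is
    integrated as the difference of two functions already known to be integrable.\<close>
  have "((\<lambda>u. f' u * e u) has_integral f 1 * e 1 - f 0 * e 0 - I) {0..1}"
    using has_integral_diff[OF parts I] by simp
  moreover have "0 \<le> M / \<omega>"
    using order_trans[OF norm_ge_zero bound(1)[of 0]] \<omega> by simp
  moreover have "norm (f' u * e u) \<le> M / \<omega>" if "u \<in> {0..1}" for u
    using bound(2)[OF that] \<omega> by (simp add: norm_mult norm_e divide_right_mono)
  ultimately have "norm (f 1 * e 1 - f 0 * e 0 - I) \<le> M / \<omega>"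
    using has_integral_bound_real[of "M / \<omega>" "{}" "\<lambda>u. f' u * e u" _ 0 1] by simp
  moreover have "norm (f 1 * e 1) \<le> M / \<omega>" "norm (f 0 * e 0) \<le> M / \<omega>"
    using bound(1)[of 0] bound(1)[of 1] \<omega> by (simp_all add: norm_mult norm_e divide_right_mono)
  moreover have "norm I \<le> norm (f 1 * e 1) + norm (f 0 * e 0) + norm (f 1 * e 1 - f 0 * e 0 - I)"
    using norm_triangle_ineq4[of "f 1 * e 1" "f 0 * e 0"]
      norm_triangle_ineq4[of "f 1 * e 1 - f 0 * e 0" "f 1 * e 1 - f 0 * e 0 - I"] by simp
  ultimately have "norm I \<le> 3 * M / \<omega>"
    by simp
  then show ?thesis
    using I by (simp add: integral_unique)
qed

lemma of_nat_powr_Complex: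
  "n > 0 \<Longrightarrow> of_nat n powr - Complex \<sigma> \<tau> = of_real (real n powr - \<sigma>) * cis (- \<tau> * ln (real n))"
  by (subst powr_def, subst exp_eq_polar) (simp add: powr_def flip: exp_of_real)

text \<open>Termwise integration: up to the real weight, the \<open>n\<close>-th term becomes the
  integral of \<open>(1 - u) * cis (u * (T * (y - ln n)))\<close>, whose real part is the
  kernel.\<close>

lemma dirichlet_fejer_sums:
  fixes a :: "nat \<Rightarrow> real" and D :: "complex \<Rightarrow> complex"
  assumes summable: "summable (\<lambda>n. \<bar>a n\<bar> * real n powr - \<sigma>)"
    and D: "\<And>u. u \<in> {0..1} \<Longrightarrow>
      (\<lambda>n. of_real (a n) * of_nat n powr - Complex \<sigma> (u * T)) sums D (Complex \<sigma> (u * T))"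
  shows "(\<lambda>n. a n * real n powr - \<sigma> * fejer (T * (y - ln (real n)))) sums
    Re (integral {0..1} (\<lambda>u. (1 - u) * D (Complex \<sigma> (u * T)) * cis (T * y * u)))"
proof -
  define f where "f n u = complex_of_real (1 - u) *
    (of_real (a n) * of_nat n powr - Complex \<sigma> (u * T)) * cis (T * y * u)" for n u
  have f_eq: "f n u = of_real ((1 - u) * a n * real n powr - \<sigma>) * cis (u * (T * (y - ln (real n))))" for n u
  \<comment> \<open>The term of index 0 vanishes because \<open>0 powr x = 0\<close>, whatever the
    value of \<open>ln 0\<close>.\<close>
  proof (cases "n = 0")
    case False
    have "f n u = of_real ((1 - u) * a n * real n powr - \<sigma>) * (cis (- (u * T) * ln (real n)) * cis (T * y * u))"
      using False by (simp add: f_def of_nat_powr_Complex mult_ac)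
    also have "cis (- (u * T) * ln (real n)) * cis (T * y * u) = cis (u * (T * (y - ln (real n))))"
      by (simp add: cis_mult algebra_simps)
    finally show ?thesis .
  qed (simp add: f_def)
  have Re_f: "Re (f n u) = a n * real n powr - \<sigma> * ((1 - u) * cos (u * (T * (y - ln (real n)))))" for n u
    by (simp add: f_eq mult_ac)
  have norm_f: "norm (f n u) \<le> \<bar>a n\<bar> * real n powr - \<sigma>" if "u \<in> {0..1}" for n u
    using that by (simp add: f_eq norm_mult abs_mult mult_left_le_one_le mult.assoc del: of_real_diff)
  have f_sums: "(\<lambda>n. f n u) sums ((1 - u) * D (Complex \<sigma> (u * T)) * cis (T * y * u))"
    if "u \<in> {0..1}" for u
    unfolding f_def of_real_diff of_real_1 by (intro sums_mult sums_mult2 D that)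
  \<comment> \<open>The majorant does not depend on \<open>u\<close>, so the partial sums converge
    uniformly and the limit passes under the integral.\<close>
  have "uniform_limit {0..1} (\<lambda>N u. \<Sum>n<N. f n u) (\<lambda>u. \<Sum>n. f n u) sequentially"
    by (rule Weierstrass_m_test[OF _ summable]) (rule norm_f)
  moreover have "continuous_on {0..1} (\<lambda>u. \<Sum>n<N. f n u)" for N
    unfolding f_eq cis_conv_exp by (intro continuous_intros)
  ultimately obtain I J where IJ: "\<And>N. ((\<lambda>u. \<Sum>n<N. f n u) has_integral I N) {0..1}"
      "((\<lambda>u. \<Sum>n. f n u) has_integral J) {0..1}" "I \<longlonglongrightarrow> J"
    by (rule uniform_limit_integral) auto
  have "((\<lambda>u. (1 - u) * D (Complex \<sigma> (u * T)) * cis (T * y * u)) has_integral J) {0..1}"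
    by (rule has_integral_eq[OF _ IJ(2)]) (use f_sums in \<open>simp add: sums_iff\<close>)
  then have J: "J = integral {0..1} (\<lambda>u. (1 - u) * D (Complex \<sigma> (u * T)) * cis (T * y * u))"
    by (simp add: integral_unique)
  have "Re (I N) = (\<Sum>n<N. a n * real n powr - \<sigma> * fejer (T * (y - ln (real n))))" for N
  proof (rule has_integral_unique)
    show "((\<lambda>u. \<Sum>n<N. a n * real n powr - \<sigma> * ((1 - u) * cos (u * (T * (y - ln (real n))))))
      has_integral Re (I N)) {0..1}"
      using has_integral_Re[OF IJ(1)[of N]] by (simp add: Re_f)
  qed (intro has_integral_sum has_integral_mult_right fejer_has_integral finite_lessThan)
  with tendsto_Re[OF IJ(3)] show ?thesis
    unfolding sums_def J by simp
qed

section \<open>A sum over logarithms bounded by the arctangent\<close>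

text \<open>The derivative of \<open>arctan (ln x - y)\<close> is
  \<open>1 / (x * (1 + (ln x - y)\<^sup>2))\<close>. Between \<open>n\<close> and
  \<open>n + 1\<close> its denominator exceeds the one at \<open>n\<close> by a factor of at most 6:
  2 from \<open>x\<close>, 3 from the quadratic.\<close>

lemma inverse_times_cauchy_le_arctan_diff:
  assumes "n \<ge> 1"
  shows "1 / (real n * (1 + (y - ln (real n))\<^sup>2)) \<le>
    6 * (arctan (ln (real (Suc n)) - y) - arctan (ln (real n) - y))"
proof -
  have n: "real n \<ge> 1"
    using assms by simp
  have "\<exists>\<xi>. real n < \<xi> \<and> \<xi> < real n + 1 \<and> arctan (ln (real n + 1) - y) - arctan (ln (real n) - y) =
      (real n + 1 - real n) * (1 / (\<xi> * (1 + (ln \<xi> - y)\<^sup>2)))"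
    by (rule MVT2) (use n in \<open>auto intro!: derivative_eq_intros simp: field_simps\<close>)
  then obtain \<xi> where \<xi>: "real n < \<xi>" "\<xi> < real n + 1"
    and eq: "arctan (ln (real n + 1) - y) - arctan (ln (real n) - y) = 1 / (\<xi> * (1 + (ln \<xi> - y)\<^sup>2))"
    by auto
  \<comment> \<open>The factor 3 comes from
    \<open>(t - w)\<^sup>2 \<le> 2 * t\<^sup>2 + 2 * w\<^sup>2\<close> and
    \<open>0 \<le> t \<le> 1\<close>.\<close>
  define t where "t = ln \<xi> - ln (real n)"
  have "t = ln (\<xi> / real n)"
    using \<xi> n by (simp add: t_def ln_div)
  also have "\<dots> \<le> \<xi> / real n - 1"
    using \<xi> n by (intro ln_le_minus_one) auto
  also have "\<dots> \<le> 1"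
    using \<xi> n by (simp add: field_simps)
  finally have "t \<le> 1" .
  moreover have "t \<ge> 0"
    using \<xi> n by (simp add: t_def)
  ultimately have "t\<^sup>2 \<le> 1"
    by (simp add: abs_square_le_1)
  define w where "w = y - ln (real n)"
  have "(t - w)\<^sup>2 + (t + w)\<^sup>2 = 2 * t\<^sup>2 + 2 * w\<^sup>2"
    by (simp add: power2_eq_square algebra_simps)
  then have "(t - w)\<^sup>2 \<le> 2 + 2 * w\<^sup>2"
    using \<open>t\<^sup>2 \<le> 1\<close> zero_le_power2[of "t + w"] by linarith
  moreover have "(t - w)\<^sup>2 = (ln \<xi> - y)\<^sup>2"
    by (simp add: t_def w_def)
  ultimately have "1 + (ln \<xi> - y)\<^sup>2 \<le> 3 * (1 + w\<^sup>2)"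
    using zero_le_power2[of w] unfolding distrib_left by linarith
  then have "\<xi> * (1 + (ln \<xi> - y)\<^sup>2) \<le> (2 * real n) * (3 * (1 + w\<^sup>2))"
    using \<xi> n by (intro mult_mono) auto
  then have "1 / ((2 * real n) * (3 * (1 + w\<^sup>2))) \<le> 1 / (\<xi> * (1 + (ln \<xi> - y)\<^sup>2))"
    using \<xi> n by (intro divide_left_mono mult_pos_pos add_pos_nonneg) auto
  then have "6 * (1 / ((2 * real n) * (3 * (1 + w\<^sup>2)))) \<le> 6 * (1 / (\<xi> * (1 + (ln \<xi> - y)\<^sup>2)))"
    by (rule mult_left_mono) simp
  also have "6 * (1 / ((2 * real n) * (3 * x))) = 1 / (real n * x)" for x
    by simp
  finally have "1 / (real n * (1 + w\<^sup>2)) \<le> 6 * (1 / (\<xi> * (1 + (ln \<xi> - y)\<^sup>2)))" .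
  then show ?thesis
    unfolding eq[symmetric] w_def by (simp add: add.commute)
qed

lemma sum_inverse_times_cauchy_le:
  "(\<Sum>n=1..<N. 1 / (real n * (1 + (y - ln (real n))\<^sup>2))) \<le> 6 * pi"
proof (cases "N \<ge> 1")
  case True
  have "(\<Sum>n=1..<N. 1 / (real n * (1 + (y - ln (real n))\<^sup>2))) \<le>
      (\<Sum>n=1..<N. 6 * (arctan (ln (real (Suc n)) - y) - arctan (ln (real n) - y)))"
    by (intro sum_mono inverse_times_cauchy_le_arctan_diff) auto
  also have "\<dots> = 6 * (arctan (ln (real N) - y) - arctan (ln (real 1) - y))"
    unfolding sum_distrib_left[symmetric]
    using True by (subst sum_Suc_diff'[of 1 N "\<lambda>n. arctan (ln (real n) - y)"]) auto
  also have "\<dots> \<le> 6 * pi"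
    using arctan_ubound[of "ln (real N) - y"] arctan_lbound[of "ln (real 1) - y"] by simp
  finally show ?thesis .
qed simp

lemma summable_powr_minus: "\<sigma> > 1 \<Longrightarrow> summable (\<lambda>n. real n powr - \<sigma>)"
  by (simp add: summable_real_powr_iff)

section \<open>A Tauberian estimate\<close>

text \<open>A positive \<open>\<delta>\<close> keeps the points \<open>1 + \<delta> + iuT\<close>
  inside the half-plane of absolute convergence. Index 0 contributes nothing, as
  \<open>0 powr x = 0\<close>.\<close>

definition fejer_sum :: "(nat \<Rightarrow> real) \<Rightarrow> real \<Rightarrow> real \<Rightarrow> real \<Rightarrow> real" where
  "fejer_sum a \<delta> T y = (\<Sum>n. a n * real n powr - (1 + \<delta>) * fejer (T * (y - ln (real n))))"

lemma summable_fejer: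
  assumes "summable (\<lambda>n. \<bar>a n\<bar> * real n powr - (1 + \<delta>))"
  shows "summable (\<lambda>n. a n * real n powr - (1 + \<delta>) * fejer (T * (y - ln (real n))))"
proof (rule summable_comparison_test'[OF assms])
  fix n
  have "\<bar>a n\<bar> * real n powr - (1 + \<delta>) * fejer (T * (y - ln (real n))) \<le>
      \<bar>a n\<bar> * real n powr - (1 + \<delta>)"
    using fejer_le_half[of "T * (y - ln (real n))"] fejer_nonneg[of "T * (y - ln (real n))"]
    by (intro mult_right_le_one_le) auto
  then show "norm (a n * real n powr - (1 + \<delta>) * fejer (T * (y - ln (real n)))) \<le>
      \<bar>a n\<bar> * real n powr - (1 + \<delta>)"
    using fejer_nonneg[of "T * (y - ln (real n))"] by (simp add: abs_mult)
qed

text \<open>Uniform in \<open>\<delta>\<close> and \<open>y\<close>: with the kernel at most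
  \<open>3 / (1 + v\<^sup>2)\<close> and the weight at most \<open>1 / n\<close>, the arctangent
  bound \<open>6 * pi\<close> applies.\<close>

lemma fejer_sum_one_le:
  assumes "\<delta> > 0"
  shows "fejer_sum (\<lambda>_. 1) \<delta> 1 y \<le> 18 * pi"
  unfolding fejer_sum_def
proof (rule suminf_le_const)
  show "summable (\<lambda>n. 1 * real n powr - (1 + \<delta>) * fejer (1 * (y - ln (real n))))"
    using assms summable_powr_minus[of "1 + \<delta>"] by (intro summable_fejer) simp
  fix N
  have "(\<Sum>n<N. 1 * real n powr - (1 + \<delta>) * fejer (1 * (y - ln (real n)))) =
      (\<Sum>n=1..<N. real n powr - (1 + \<delta>) * fejer (y - ln (real n)))"
    by (rule sum.mono_neutral_cong_right) auto
  also have "\<dots> \<le> (\<Sum>n=1..<N. 3 * (1 / (real n * (1 + (y - ln (real n))\<^sup>2))))"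
  proof (rule sum_mono)
    fix n assume "n \<in> {1..<N}"
    then have "real n powr - (1 + \<delta>) \<le> real n powr - 1"
      using assms by (intro powr_mono) auto
    then have "real n powr - (1 + \<delta>) * fejer (y - ln (real n)) \<le> (1 / real n) * (3 / (1 + (y - ln (real n))\<^sup>2))"
      using fejer_nonneg fejer_le_cauchy by (intro mult_mono) (auto simp: powr_minus_divide)
    then show "real n powr - (1 + \<delta>) * fejer (y - ln (real n)) \<le> 3 * (1 / (real n * (1 + (y - ln (real n))\<^sup>2)))"
      by simp
  qed
  also have "\<dots> \<le> 18 * pi"
    using sum_inverse_times_cauchy_le[of y N] unfolding sum_distrib_left[symmetric] by linarith
  finally show "(\<Sum>n<N. 1 * real n powr - (1 + \<delta>) * fejer (1 * (y - ln (real n)))) \<le> 18 * pi" .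
qed

text \<open>At least \<open>exp y / T - 1\<close> integers have their logarithm between
  \<open>y\<close> and \<open>y + 1 / T\<close>, where the kernel is at least \<open>1 / 4\<close>.
  The loss \<open>exp (- y)\<close> in the bound stems from this \<open>- 1\<close>.\<close>

lemma fejer_sum_one_ge:
  assumes T: "T \<ge> 1" and y: "y \<ge> 1"
  shows "fejer_sum (\<lambda>_. 1) (1 / y) T y \<ge> (1 / T - exp (- y)) * exp (- 3) / 4"
proof -
  define A where "A = {nat \<lfloor>exp y\<rfloor><..nat \<lfloor>exp (y + 1 / T)\<rfloor>}"
  have A: "exp y < real n" "real n \<le> exp (y + 1 / T)" if "n \<in> A" for n
  proof -
    have "\<lfloor>exp y\<rfloor> < int n" "int n \<le> \<lfloor>exp (y + 1 / T)\<rfloor>"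
      using that by (auto simp: A_def)
    then show "exp y < real n" "real n \<le> exp (y + 1 / T)"
      by (simp_all add: floor_less_iff le_floor_iff)
  qed
  have "exp y \<le> exp (y + 1 / T)"
    using T by simp
  then have "real (card A) = real_of_int \<lfloor>exp (y + 1 / T)\<rfloor> - real_of_int \<lfloor>exp y\<rfloor>"
    by (simp add: A_def of_nat_diff nat_mono floor_mono)
  moreover have "exp y * (1 + 1 / T) \<le> exp (y + 1 / T)"
    unfolding exp_add by (intro mult_left_mono exp_ge_add_one_self) auto
  ultimately have card: "real (card A) \<ge> exp y / T - 1"
    by (simp add: algebra_simps) linarith
  have summand: "exp (- y - 3) * (1 / 4) \<le> 1 * real n powr - (1 + 1 / y) * fejer (T * (y - ln (real n)))"
    if "n \<in> A" for n
  proof -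
    have n: "real n > 0"
      using A[OF that] exp_gt_zero[of y] by linarith
    have ln: "y < ln (real n)" "ln (real n) \<le> y + 1 / T"
      using A[OF that] n exp_less_cancel_iff[of y "ln (real n)"] exp_le_cancel_iff[of "ln (real n)" "y + 1 / T"]
      by simp_all
    have "1 / T \<le> 1"
      using T by simp
    \<comment> \<open>The choice \<open>\<delta> = 1 / y\<close> matters here: the right-hand side
      is \<open>y + 2 + 1 / y\<close>, so \<open>\<delta>\<close> costs only a constant
      factor.\<close>
    then have "(1 + 1 / y) * ln (real n) \<le> (1 + 1 / y) * (y + 1)"
      using ln(2) y by (intro mult_left_mono) (linarith, simp)
    also have "\<dots> \<le> y + 3"
      using y by (simp add: field_simps)
    finally have "exp (- y - 3) \<le> real n powr - (1 + 1 / y)"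
      using n by (simp add: powr_def algebra_simps)
    moreover have "\<bar>T * (y - ln (real n))\<bar> \<le> 1"
      using ln T by (simp add: abs_mult field_simps)
    then have "1 / 4 \<le> fejer (T * (y - ln (real n)))"
      by (rule fejer_ge_quarter)
    ultimately show ?thesis
      unfolding mult_1 by (intro mult_mono) auto
  qed
  have "(1 / T - exp (- y)) * exp (- 3) / 4 = (exp y / T - 1) * (exp (- y - 3) * (1 / 4))"
    by (simp add: field_simps exp_diff exp_minus)
  also have "\<dots> \<le> real (card A) * (exp (- y - 3) * (1 / 4))"
    by (intro mult_right_mono card) auto
  also have "\<dots> = (\<Sum>n\<in>A. exp (- y - 3) * (1 / 4))"
    by simp
  also have "\<dots> \<le> (\<Sum>n\<in>A. 1 * real n powr - (1 + 1 / y) * fejer (T * (y - ln (real n))))"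
    by (intro sum_mono summand)
  also have "\<dots> \<le> fejer_sum (\<lambda>_. 1) (1 / y) T y"
    unfolding fejer_sum_def using summable_powr_minus[of "1 + 1 / y"] y fejer_nonneg
    by (intro sum_le_suminf summable_fejer) (auto simp: A_def)
  finally show ?thesis .
qed

text \<open>\<open>G\<close> is holomorphic across the line Re s = 1, so \<open>G\<close> and its
  derivative are bounded on a compact rectangle containing the segments of integration for all
  \<open>\<delta> \<le> 1\<close>. Hence \<open>M\<close> depends on \<open>T\<close>, but neither
  on \<open>\<delta>\<close> nor on \<open>y\<close>.\<close>

lemma fejer_sum_diff_bound:
  fixes a :: "nat \<Rightarrow> real" and G :: "complex \<Rightarrow> complex"
  assumes summable: "\<And>\<sigma>. \<sigma> > 1 \<Longrightarrow> summable (\<lambda>n. \<bar>a n\<bar> * real n powr - \<sigma>)"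
    and S: "open S" "{s. Re s \<ge> 1} \<subseteq> S" and G: "G holomorphic_on S"
    and sums: "\<And>s. Re s > 1 \<Longrightarrow> (\<lambda>n. of_real (a n - 1) * of_nat n powr - s) sums G s"
    and T: "T > 0"
  obtains M where "M \<ge> 0"
    "\<And>\<delta> y. 0 < \<delta> \<Longrightarrow> \<delta> \<le> 1 \<Longrightarrow> y > 0 \<Longrightarrow> \<bar>fejer_sum a \<delta> T y - fejer_sum (\<lambda>_. 1) \<delta> T y\<bar> \<le> M / y"
proof -
  let ?K = "cbox (Complex 1 0) (Complex 2 T)"
  have K: "?K \<subseteq> S"
    using S(2) by (auto simp: in_cbox_complex_iff)
  have "continuous_on ?K G" "continuous_on ?K (deriv G)"
    using G S(1) K holomorphic_deriv holomorphic_on_imp_continuous_on continuous_on_subset by blast+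
  then have "bounded (G ` ?K)" "bounded (deriv G ` ?K)"
    by (auto intro!: compact_imp_bounded compact_continuous_image)
  then obtain B1 B2 where B: "\<And>s. s \<in> ?K \<Longrightarrow> norm (G s) \<le> B1" "\<And>s. s \<in> ?K \<Longrightarrow> norm (deriv G s) \<le> B2"
    unfolding bounded_iff by blast
  have "Complex 1 0 \<in> ?K"
    using T by (simp add: in_cbox_complex_iff)
  from B(1)[OF this] B(2)[OF this] have B_nonneg: "B1 \<ge> 0" "B2 \<ge> 0"
    using norm_ge_zero order_trans by blast+
  \<comment> \<open>Bounds both the integrand \<open>f\<close> and its derivative, where the chain
    rule brings in the factor \<open>T\<close>.\<close>
  define M where "M = B1 + B2 * T"
  have M: "M \<ge> 0"
    using B_nonneg T by (simp add: M_def)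
  show thesis
  proof
    show "3 * M / T \<ge> 0"
      using M T by simp
    fix \<delta> y :: real
    assume \<delta>: "0 < \<delta>" "\<delta> \<le> 1" and y: "y > 0"
    define z where "z u = Complex (1 + \<delta>) (u * T)" for u
    define f where "f u = (1 - complex_of_real u) * G (z u)" for u
    define f' where "f' u = (1 - complex_of_real u) * (deriv G (z u) * (\<i> * T)) - G (z u)" for u
    have z: "z u \<in> ?K" if "u \<in> {0..1}" for u
      using that \<delta> T by (auto simp: z_def in_cbox_complex_iff mult_left_le_one_le)
    have "z = (\<lambda>u. of_real (1 + \<delta>) + of_real u * (\<i> * of_real T))"
      by (auto simp: z_def complex_eq_iff)
    then have z': "(z has_vector_derivative \<i> * T) (at u within {0..1})" for u
      by (auto intro!: derivative_eq_intros)
    have f': "(f has_vector_derivative f' u) (at u within {0..1})" if u: "u \<in> {0..1}" for u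
    proof -
      have "(G has_field_derivative deriv G (z u)) (at (z u))"
        using G S(1) K z[OF u] by (auto intro: holomorphic_derivI)
      then have "((G \<circ> z) has_vector_derivative (\<i> * T) * deriv G (z u)) (at u within {0..1})"
        by (intro field_vector_diff_chain_within z') (auto intro: has_field_derivative_at_within)
      then have Gz: "((\<lambda>u. G (z u)) has_vector_derivative (\<i> * T) * deriv G (z u)) (at u within {0..1})"
        by (simp only: comp_def)
      have "((\<lambda>u. 1 - complex_of_real u) has_vector_derivative - 1) (at u within {0..1})"
        by (auto intro!: derivative_eq_intros)
      from has_vector_derivative_mult[OF this Gz] show ?thesis
        unfolding f_def f'_def by (rule has_vector_derivative_eq_rhs) (simp add: mult.commute)
    qed
    have norm1: "norm (1 - complex_of_real u) \<le> 1" if "u \<in> {0..1}" for u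
      using norm_of_real[of "1 - u", where 'a = complex] that by simp
    have "norm (f u) \<le> M" if u: "u \<in> {0..1}" for u
    proof -
      have "norm (f u) \<le> 1 * B1"
        unfolding f_def norm_mult by (intro mult_mono norm1 B z u) auto
      then show ?thesis
        using B_nonneg T by (simp add: M_def add_increasing2)
    qed
    moreover have "norm (f' u) \<le> M" if u: "u \<in> {0..1}" for u
    proof -
      have "norm (f' u) \<le> norm ((1 - complex_of_real u) * (deriv G (z u) * (\<i> * T))) + norm (G (z u))"
        unfolding f'_def by (rule norm_triangle_ineq4)
      also have "\<dots> \<le> 1 * (B2 * T) + B1"
        unfolding norm_mult using T
        by (intro add_mono mult_mono norm1 B z u) (auto simp: B_nonneg)
      finally show ?thesis
        by (simp add: M_def)
    qed
    ultimately have le: "norm (integral {0..1} (\<lambda>u. f u * cis (T * y * u))) \<le> 3 * M / (T * y)"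
      using T y f' by (intro norm_integral_mult_cis_le) auto
    have summable_1: "summable (\<lambda>n. \<bar>1 :: real\<bar> * real n powr - (1 + \<delta>))"
      using \<delta> summable_powr_minus[of "1 + \<delta>"] by simp
    have "summable (\<lambda>n. \<bar>a n - 1\<bar> * real n powr - (1 + \<delta>))"
    proof (rule summable_comparison_test')
      show "summable (\<lambda>n. \<bar>a n\<bar> * real n powr - (1 + \<delta>) + \<bar>1\<bar> * real n powr - (1 + \<delta>))"
        using \<delta> by (intro summable_add summable summable_1) auto
      show "norm (\<bar>a n - 1\<bar> * real n powr - (1 + \<delta>)) \<le>
        \<bar>a n\<bar> * real n powr - (1 + \<delta>) + \<bar>1\<bar> * real n powr - (1 + \<delta>)" for n
        unfolding distrib_right[symmetric] by (auto intro!: mult_right_mono)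
    qed
    then have "(\<lambda>n. (a n - 1) * real n powr - (1 + \<delta>) * fejer (T * (y - ln (real n)))) sums
        Re (integral {0..1} (\<lambda>u. f u * cis (T * y * u)))"
      unfolding f_def z_def using \<delta> by (intro dirichlet_fejer_sums sums) auto
    moreover have "(\<lambda>n. (a n - 1) * real n powr - (1 + \<delta>) * fejer (T * (y - ln (real n)))) sums
        (fejer_sum a \<delta> T y - fejer_sum (\<lambda>_. 1) \<delta> T y)"
    proof -
      have "(\<lambda>n. a n * real n powr - (1 + \<delta>) * fejer (T * (y - ln (real n))) -
          1 * real n powr - (1 + \<delta>) * fejer (T * (y - ln (real n)))) sums
        (fejer_sum a \<delta> T y - fejer_sum (\<lambda>_. 1) \<delta> T y)"
        unfolding fejer_sum_def
        by (intro sums_diff summable_sums summable_fejer summable summable_1) (use \<delta> in auto)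
      then show ?thesis
        by (simp add: left_diff_distrib)
    qed
    ultimately have "fejer_sum a \<delta> T y - fejer_sum (\<lambda>_. 1) \<delta> T y =
        Re (integral {0..1} (\<lambda>u. f u * cis (T * y * u)))"
      by (rule sums_unique2[symmetric])
    then have "\<bar>fejer_sum a \<delta> T y - fejer_sum (\<lambda>_. 1) \<delta> T y\<bar> \<le> 3 * M / (T * y)"
      using order_trans[OF abs_Re_le_cmod le] by simp
    then show "\<bar>fejer_sum a \<delta> T y - fejer_sum (\<lambda>_. 1) \<delta> T y\<bar> \<le> 3 * M / T / y"
      by simp
  qed
qed

lemma finite_log_window: "finite {n. n > 0 \<and> \<bar>y - ln (real n)\<bar> \<le> \<eta>}"
proof (rule finite_subset)
  show "{n. n > 0 \<and> \<bar>y - ln (real n)\<bar> \<le> \<eta>} \<subseteq> {..nat \<lfloor>exp (y + \<eta>)\<rfloor>}"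
  proof
    fix n assume "n \<in> {n. n > 0 \<and> \<bar>y - ln (real n)\<bar> \<le> \<eta>}"
    then have "real n \<le> exp (y + \<eta>)"
      using exp_le_cancel_iff[of "ln (real n)" "y + \<eta>"] by (simp add: abs_le_iff)
    then show "n \<in> {..nat \<lfloor>exp (y + \<eta>)\<rfloor>}"
      by (simp add: le_nat_floor)
  qed
qed simp

text \<open>The constants are chosen in the order \<open>C\<close> (from \<open>T = 1\<close>),
  \<open>T\<close> (from \<open>C\<close> and \<open>\<eta>\<close>), \<open>M\<close> (from
  \<open>T\<close>), and last \<open>y\<close>. However large \<open>M\<close> is,
  \<open>M / y\<close> is eventually negligible.\<close>

lemma window_mass_lower_bound:
  fixes a :: "nat \<Rightarrow> real" and G :: "complex \<Rightarrow> complex"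
  assumes nonneg: "\<And>n. a n \<ge> 0"
    and summable: "\<And>\<sigma>. \<sigma> > 1 \<Longrightarrow> summable (\<lambda>n. a n * real n powr - \<sigma>)"
    and S: "open S" "{s. Re s \<ge> 1} \<subseteq> S" and G: "G holomorphic_on S"
    and sums: "\<And>s. Re s > 1 \<Longrightarrow> (\<lambda>n. of_real (a n - 1) * of_nat n powr - s) sums G s"
    and \<eta>: "\<eta> > 0"
  obtains c where "c > 0"
    "eventually (\<lambda>y. c \<le> (\<Sum>n | n > 0 \<and> \<bar>y - ln (real n)\<bar> \<le> \<eta>. a n / real n)) at_top"
proof -
  have summable': "summable (\<lambda>n. \<bar>a n\<bar> * real n powr - \<sigma>)" if "\<sigma> > 1" for \<sigma>
    using summable[OF that] nonneg by simp
  note bound = fejer_sum_diff_bound[OF summable' S G sums]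
  obtain M1 where M1: "M1 \<ge> 0" "\<And>\<delta> y. 0 < \<delta> \<Longrightarrow> \<delta> \<le> 1 \<Longrightarrow> y > 0 \<Longrightarrow>
      \<bar>fejer_sum a \<delta> 1 y - fejer_sum (\<lambda>_. 1) \<delta> 1 y\<bar> \<le> M1 / y"
    by (rule bound[of 1]) auto
  define C where "C = 18 * pi + M1"
  have C: "C > 0"
    using M1(1) by (simp add: C_def add_pos_nonneg)
  have le_C: "fejer_sum a \<delta> 1 y \<le> C" if "0 < \<delta>" "\<delta> \<le> 1" "y \<ge> 1" for \<delta> y
  proof -
    have "M1 / y \<le> M1"
      using that M1(1) divide_left_mono[of 1 y M1] by simp
    then show ?thesis
      using M1(2)[of \<delta> y] fejer_sum_one_le[of \<delta> y] that by (simp add: C_def)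
  qed
  let ?w = "\<lambda>\<delta> n. a n * real n powr - (1 + \<delta>)"
  have summable_cauchy: "summable (\<lambda>n. ?w \<delta> n * (1 / (1 + (y - ln (real n))\<^sup>2)))" if "0 < \<delta>" for \<delta> y
  proof (rule summable_comparison_test'[OF summable[of "1 + \<delta>"]])
    fix n
    have "?w \<delta> n * (1 / (1 + (y - ln (real n))\<^sup>2)) \<le> ?w \<delta> n"
      using nonneg by (intro mult_right_le_one_le) (auto simp: divide_le_eq_1 add_pos_nonneg)
    then show "norm (?w \<delta> n * (1 / (1 + (y - ln (real n))\<^sup>2))) \<le> ?w \<delta> n"
      using nonneg by (simp add: abs_mult)
  qed (use that in auto)
  \<comment> \<open>The kernels centred at \<open>y\<close> and \<open>y + pi\<close> together
    dominate the Cauchy weight up to the factor 20, and the bound \<open>C\<close> applies at both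
    centres.\<close>
  have cauchy_le: "(\<Sum>n. ?w \<delta> n * (1 / (1 + (y - ln (real n))\<^sup>2))) \<le> 40 * C"
    if \<delta>: "0 < \<delta>" "\<delta> \<le> 1" and y: "y \<ge> 1" for \<delta> y
  proof -
    let ?k = "\<lambda>y n. ?w \<delta> n * fejer (1 * (y - ln (real n)))"
    have sk: "summable (?k y)" for y
      using \<delta> by (intro summable_fejer summable') auto
    have "(\<Sum>n. ?w \<delta> n * (1 / (1 + (y - ln (real n))\<^sup>2))) \<le> (\<Sum>n. 20 * (?k y n + ?k (y + pi) n))"
    proof (intro suminf_le summable_cauchy summable_mult summable_add sk \<delta>)
      fix n
      have "1 / (20 * (1 + (y - ln (real n))\<^sup>2)) \<le>
          fejer (y - ln (real n)) + fejer (y - ln (real n) + pi)"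
        by (rule fejer_shift_ge)
      then have "20 * (1 / (20 * (1 + (y - ln (real n))\<^sup>2))) \<le>
          20 * (fejer (y - ln (real n)) + fejer (y - ln (real n) + pi))"
        by (rule mult_left_mono) simp
      also have "20 * (1 / (20 * x)) = 1 / x" for x :: real
        by simp
      finally have "1 / (1 + (y - ln (real n))\<^sup>2) \<le>
          20 * (fejer (y - ln (real n)) + fejer (y + pi - ln (real n)))"
        by (simp add: diff_add_eq)
      then have "?w \<delta> n * (1 / (1 + (y - ln (real n))\<^sup>2)) \<le>
          ?w \<delta> n * (20 * (fejer (y - ln (real n)) + fejer (y + pi - ln (real n))))"
        using nonneg by (intro mult_left_mono) auto
      then show "?w \<delta> n * (1 / (1 + (y - ln (real n))\<^sup>2)) \<le> 20 * (?k y n + ?k (y + pi) n)"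
        by (simp add: algebra_simps)
    qed
    also have "\<dots> = 20 * (fejer_sum a \<delta> 1 y + fejer_sum a \<delta> 1 (y + pi))"
      unfolding fejer_sum_def by (subst suminf_mult suminf_add[symmetric], intro summable_add sk)+ (intro sk refl)+
    also have "\<dots> \<le> 20 * (C + C)"
      using le_C[OF \<delta>, of y] le_C[OF \<delta>, of "y + pi"] y pi_gt_zero by (intro mult_left_mono add_mono) auto
    finally show ?thesis
      by simp
  qed
  define \<kappa> where "\<kappa> = exp (- 3 :: real)"
  \<comment> \<open>\<open>c2 / T\<^sup>2\<close> will bound the contribution from outside the
    window: for \<open>\<bar>v\<bar> > \<eta>\<close>, \<open>1 / v\<^sup>2\<close> is at most
    \<open>1 + 1 / \<eta>\<^sup>2\<close> times the Cauchy weight, whose total is at most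
    \<open>40 * C\<close>.\<close>
  define c2 where "c2 = 2 * (1 + 1 / \<eta>\<^sup>2) * (40 * C)"
  have \<kappa>: "\<kappa> > 0" and c2: "c2 > 0"
    using C by (auto simp: \<kappa>_def c2_def intro!: mult_pos_pos add_pos_nonneg)
  \<comment> \<open>The outside contribution decays like \<open>1 / T\<^sup>2\<close>, the main term
    \<open>\<kappa> / (4 * T)\<close> only like \<open>1 / T\<close>. This \<open>T\<close> makes
    the former at most a quarter of the latter.\<close>
  define T where "T = max 1 (16 * c2 / \<kappa>)"
  have T: "T \<ge> 1" "T \<ge> 16 * c2 / \<kappa>"
    by (auto simp: T_def)
  have "c2 / T\<^sup>2 \<le> \<kappa> / (16 * T)"
    using T \<kappa> by (simp add: field_simps power2_eq_square)
  obtain M where M: "M \<ge> 0" "\<And>\<delta> y. 0 < \<delta> \<Longrightarrow> \<delta> \<le> 1 \<Longrightarrow> y > 0 \<Longrightarrow>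
      \<bar>fejer_sum a \<delta> T y - fejer_sum (\<lambda>_. 1) \<delta> T y\<bar> \<le> M / y"
    by (rule bound[of T]) (use T in auto)
  have window: "fejer_sum a (1 / y) T y \<le>
      (\<Sum>n | n > 0 \<and> \<bar>y - ln (real n)\<bar> \<le> \<eta>. a n / real n) + c2 / T\<^sup>2" if y: "y \<ge> 1" for y
  proof -
    define W where "W = {n. n > 0 \<and> \<bar>y - ln (real n)\<bar> \<le> \<eta>}"
    have W: "finite W"
      unfolding W_def by (rule finite_log_window)
    let ?q = "\<lambda>n. 2 * (1 + 1 / \<eta>\<^sup>2) / T\<^sup>2 * (?w (1 / y) n * (1 / (1 + (y - ln (real n))\<^sup>2)))"
    have sq: "summable ?q"
      using y by (intro summable_mult summable_cauchy) auto
    \<comment> \<open>Inside the window the kernel is bounded by 1 and the weight by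
      \<open>1 / n\<close>. The nonnegative \<open>?q n\<close> is added there too, so that the
      majorant splits into a finite sum and one full series.\<close>
    have "fejer_sum a (1 / y) T y \<le> (\<Sum>n. (if n \<in> W then a n / real n else 0) + ?q n)"
      unfolding fejer_sum_def
    proof (intro suminf_le summable_add sq summable_fejer summable')
      fix n
      have q: "?q n \<ge> 0"
        using nonneg by simp
      consider "n = 0" | "n \<in> W" | "n > 0" "n \<notin> W"
        by blast
      then show "?w (1 / y) n * fejer (T * (y - ln (real n))) \<le> (if n \<in> W then a n / real n else 0) + ?q n"
      proof cases
        case 2
        then have "real n \<ge> 1"
          by (simp add: W_def)
        then have "real n powr - (1 + 1 / y) \<le> real n powr - 1"
          using y by (intro powr_mono) auto
        then have "?w (1 / y) n * fejer (T * (y - ln (real n))) \<le> (a n * (1 / real n)) * 1"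
          using nonneg fejer_nonneg fejer_le_half[of "T * (y - ln (real n))"]
          by (intro mult_mono) (auto simp: powr_minus_divide)
        then show ?thesis
          using 2 q by simp
      next
        case 3
        define v where "v = y - ln (real n)"
        have v: "\<bar>v\<bar> > \<eta>"
          using 3 by (simp add: W_def v_def)
        then have v2: "v\<^sup>2 \<ge> \<eta>\<^sup>2" "v \<noteq> 0"
          using \<eta> by (auto simp flip: abs_le_square_iff)
        have "1 / v\<^sup>2 \<le> 1 / \<eta>\<^sup>2"
          using v2 \<eta> by (intro divide_left_mono) auto
        then have "(1 + v\<^sup>2) / v\<^sup>2 \<le> 1 + 1 / \<eta>\<^sup>2"
          using v2 by (simp add: add_divide_distrib)
        then have "((1 + v\<^sup>2) / v\<^sup>2) * (2 / (T\<^sup>2 * (1 + v\<^sup>2))) \<le> (1 + 1 / \<eta>\<^sup>2) * (2 / (T\<^sup>2 * (1 + v\<^sup>2)))"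
          by (intro mult_right_mono) auto
        moreover have "((1 + v\<^sup>2) / v\<^sup>2) * (2 / (T\<^sup>2 * (1 + v\<^sup>2))) = 2 / (T * v)\<^sup>2"
        proof -
          have cancel: "(x / p) * (2 / (q * x)) = 2 / (q * p)" if "x \<noteq> 0" for x p q :: real
            using that by simp
          have "1 + v\<^sup>2 \<noteq> 0"
            using zero_le_power2[of v] by linarith
          then show ?thesis
            unfolding power_mult_distrib by (rule cancel)
        qed
        moreover have "fejer (T * v) \<le> 2 / (T * v)\<^sup>2"
          using v2 T by (intro fejer_le_inverse_square) auto
        ultimately have "fejer (T * v) \<le> 2 * (1 + 1 / \<eta>\<^sup>2) / T\<^sup>2 * (1 / (1 + v\<^sup>2))"
          by (simp add: mult_ac)
        then have "?w (1 / y) n * fejer (T * v) \<le> ?w (1 / y) n * (2 * (1 + 1 / \<eta>\<^sup>2) / T\<^sup>2 * (1 / (1 + v\<^sup>2)))"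
          using nonneg by (intro mult_left_mono) auto
        also have "\<dots> = ?q n"
          by (simp add: v_def mult_ac)
        finally show ?thesis
          using 3 by (simp add: v_def)
      qed auto
    qed (use y W in \<open>auto intro: summable_finite\<close>)
    also have "\<dots> = (\<Sum>n\<in>W. a n / real n) + (\<Sum>n. ?q n)"
      using sums_If_finite_set[OF W, of "\<lambda>n. a n / real n"] sq
      by (intro sums_unique[symmetric] sums_add summable_sums) auto
    also have "(\<Sum>n. ?q n) = 2 * (1 + 1 / \<eta>\<^sup>2) / T\<^sup>2 * (\<Sum>n. ?w (1 / y) n * (1 / (1 + (y - ln (real n))\<^sup>2)))"
      using y by (intro suminf_mult summable_cauchy) auto
    also have "\<dots> \<le> 2 * (1 + 1 / \<eta>\<^sup>2) / T\<^sup>2 * (40 * C)"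
      using y by (intro mult_left_mono cauchy_le) auto
    also have "\<dots> = c2 / T\<^sup>2"
      by (simp add: c2_def)
    finally show ?thesis
      by (simp add: W_def)
  qed
  have "((\<lambda>y. exp (- y) * \<kappa> / 4 + M / y) \<longlongrightarrow> 0) at_top"
    by real_asymp
  then have "eventually (\<lambda>y. exp (- y) * \<kappa> / 4 + M / y < \<kappa> / (16 * T)) at_top"
    using \<kappa> T by (intro order_tendstoD(2)) auto
  moreover have "eventually (\<lambda>y. y \<ge> (1 :: real)) at_top"
    by (rule eventually_ge_at_top)
  ultimately have "eventually (\<lambda>y. \<kappa> / (8 * T) \<le> (\<Sum>n | n > 0 \<and> \<bar>y - ln (real n)\<bar> \<le> \<eta>. a n / real n)) at_top"
  proof eventually_elim
    case (elim y)
    have "fejer_sum a (1 / y) T y \<ge> fejer_sum (\<lambda>_. 1) (1 / y) T y - M / y"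
      using M(2)[of "1 / y" y] elim(2) by (simp add: abs_le_iff)
    moreover have "fejer_sum (\<lambda>_. 1) (1 / y) T y \<ge> \<kappa> / (4 * T) - exp (- y) * \<kappa> / 4"
      using fejer_sum_one_ge[OF T(1) elim(2)] by (simp add: \<kappa>_def left_diff_distrib diff_divide_distrib)
    \<comment> \<open>Counting in units of \<open>\<kappa> / (16 * T)\<close>: the main term is 4,
      the errors decaying in \<open>y\<close> are below 1, the outside contribution is at most 1, so
      2 remain.\<close>
    moreover have "\<kappa> / (4 * T) = 4 * (\<kappa> / (16 * T))" "\<kappa> / (8 * T) = 2 * (\<kappa> / (16 * T))"
      by simp_all
    ultimately show ?case
      using window[OF elim(2)] \<open>c2 / T\<^sup>2 \<le> \<kappa> / (16 * T)\<close> elim(1) by linarith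
  qed
  then show thesis
    using \<kappa> T by (intro that[of "\<kappa> / (8 * T)"]) auto
qed

section \<open>The zeta function\<close>

lemma norm_of_nat_powr: "norm (of_nat n powr s :: complex) = real n powr Re s"
  by (simp add: norm_powr_real_powr)

definition zeta_term :: "nat \<Rightarrow> complex \<Rightarrow> complex" where
  "zeta_term n s = (s - 1) * of_nat n powr - s - of_nat n powr (1 - s) + of_nat (Suc n) powr (1 - s)"

text \<open>The holomorphic function \<open>(s - 1) \<zeta>(s)\<close> on the right half-plane; the summands are
  \<open>(s - 1)\<close> times the differences between \<open>n\<^sup>-\<^sup>s\<close> and the integral of \<open>x\<^sup>-\<^sup>s\<close> over \<open>[n, n + 1]\<close>.\<close>

definition zeta_reg :: "complex \<Rightarrow> complex" where
  "zeta_reg s = 1 + (\<Sum>n. zeta_term (Suc n) s)"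

text \<open>Two mean value estimates: the term is an increment over \<open>[n, n + 1]\<close> of a
  function with derivative \<open>(s - 1) * (n powr - s - z powr - s)\<close>, and this difference
  is again an increment. The power gained makes the series converge for Re s > 0.\<close>

lemma norm_zeta_term_le:
  assumes n: "n \<ge> 1" and s: "Re s > 0"
  shows "norm (zeta_term n s) \<le> norm (s - 1) * norm s * real n powr (- Re s - 1)"
proof -
  define I where "I = closed_segment (complex_of_nat n) (complex_of_nat (Suc n))"
  have I: "\<exists>x. z = complex_of_real x \<and> real n \<le> x \<and> x \<le> real n + 1" if "z \<in> I" for z
  proof -
    have "z \<in> closed_segment (complex_of_real (real n)) (complex_of_real (real n + 1))"
      using that by (simp add: I_def add.commute)
    then show ?thesis
      unfolding closed_segment_of_real by (auto simp: closed_segment_eq_real_ivl)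
  qed
  have ends: "of_nat n \<in> I" "of_nat (Suc n) \<in> I"
    by (simp_all add: I_def)
  have I_nonpos: "z \<notin> \<real>\<^sub>\<le>\<^sub>0" if "z \<in> I" for z
    using I[OF that] n by auto
  have powr_le: "norm (z powr (- s - 1)) \<le> real n powr (- Re s - 1)" if z: "z \<in> I" for z
  proof -
    from I[OF z] obtain x where x: "z = of_real x" "real n \<le> x"
      by blast
    then have "norm (z powr (- s - 1)) = x powr (- Re s - 1)"
      using n by (simp add: norm_powr_real_powr)
    also have "\<dots> \<le> real n powr (- Re s - 1)"
      using x n s by (intro powr_mono2') auto
    finally show ?thesis .
  qed
  have diff_le: "norm (of_nat n powr - s - z powr - s) \<le> norm s * real n powr (- Re s - 1)" if z: "z \<in> I" for z
  proof -
    have "norm (of_nat n powr - s - z powr - s) \<le> (norm s * real n powr (- Re s - 1)) * norm (of_nat n - z)"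
    proof (rule field_differentiable_bound[of I "\<lambda>z. z powr - s" "\<lambda>z. - s * z powr (- s - 1)"])
      show "((\<lambda>z. z powr - s) has_field_derivative - s * z powr (- s - 1)) (at z within I)" if "z \<in> I" for z
        by (rule has_field_derivative_at_within[OF has_field_derivative_powr[OF I_nonpos[OF that]]])
      show "norm (- s * z powr (- s - 1)) \<le> norm s * real n powr (- Re s - 1)" if "z \<in> I" for z
        using powr_le[OF that] by (simp add: norm_mult mult_left_mono)
    qed (use z ends in \<open>auto simp: I_def\<close>)
    also have "norm (of_nat n - z) \<le> 1"
    proof -
      from I[OF z] obtain x where x: "z = of_real x" "real n \<le> x" "x \<le> real n + 1"
        by blast
      then have "of_nat n - z = of_real (real n - x)"
        by simp
      then show ?thesis
        using x by (simp only: norm_of_real)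
    qed
    finally show ?thesis
      by (simp add: mult_left_mono)
  qed
  define \<phi> where "\<phi> z = (s - 1) * of_nat n powr - s * z + z powr (1 - s)" for z
  have "norm (\<phi> (of_nat (Suc n)) - \<phi> (of_nat n)) \<le>
      (norm (s - 1) * (norm s * real n powr (- Re s - 1))) * norm (of_nat (Suc n) - of_nat n :: complex)"
  proof (rule field_differentiable_bound[of I \<phi> "\<lambda>z. (s - 1) * (of_nat n powr - s - z powr - s)"])
    show "(\<phi> has_field_derivative (s - 1) * (of_nat n powr - s - z powr - s)) (at z within I)" if "z \<in> I" for z
      unfolding \<phi>_def using I_nonpos[OF that]
      by (auto intro!: derivative_eq_intros has_field_derivative_at_within[OF has_field_derivative_powr]
          simp: algebra_simps)
    show "norm ((s - 1) * (of_nat n powr - s - z powr - s)) \<le>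
        norm (s - 1) * (norm s * real n powr (- Re s - 1))" if "z \<in> I" for z
      unfolding norm_mult by (intro mult_left_mono diff_le that) auto
  qed (use ends in \<open>auto simp: I_def\<close>)
  also have "\<phi> (of_nat (Suc n)) - \<phi> (of_nat n) = zeta_term n s"
    by (simp add: \<phi>_def zeta_term_def algebra_simps)
  finally show ?thesis
    by (simp add: mult.assoc)
qed

text \<open>On the disc of radius \<open>Re z / 2\<close> about \<open>z\<close> the terms are
  bounded by a constant times \<open>n powr - (1 + Re z / 2)\<close>, so convergence is locally
  uniform.\<close>

lemma zeta_reg_holomorphic: "zeta_reg holomorphic_on {s. Re s > 0}"
proof -
  have "(\<lambda>s. \<Sum>n. zeta_term (Suc n) s) holomorphic_on {s. Re s > 0}"
  proof (rule holomorphic_uniform_sequence)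
    show "(\<lambda>s. \<Sum>n<N. zeta_term (Suc n) s) holomorphic_on {s. Re s > 0}" for N
      unfolding zeta_term_def by (intro holomorphic_intros) (auto simp del: of_nat_Suc)
    fix z assume "z \<in> {s. Re s > 0}"
    then have z: "Re z > 0"
      by simp
    define R where "R = norm z + Re z / 2"
    have ball: "Re s \<ge> Re z / 2 \<and> norm s \<le> R" if "s \<in> cball z (Re z / 2)" for s
    proof -
      have "norm (z - s) \<le> Re z / 2"
        using that by (simp add: dist_norm)
      then show ?thesis
        using abs_Re_le_cmod[of "z - s"] norm_triangle_sub[of s z] by (simp add: R_def norm_minus_commute)
    qed
    have "uniform_limit (cball z (Re z / 2)) (\<lambda>N s. \<Sum>n<N. zeta_term (Suc n) s)
        (\<lambda>s. \<Sum>n. zeta_term (Suc n) s) sequentially"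
    proof (rule Weierstrass_m_test)
      fix n s assume s: "s \<in> cball z (Re z / 2)"
      have "norm (s - 1) \<le> R + 1"
        using ball[OF s] norm_triangle_ineq4[of s 1] by simp
      moreover have "real (Suc n) powr (- Re s - 1) \<le> real (Suc n) powr (- (1 + Re z / 2))"
        using ball[OF s] by (intro powr_mono) auto
      ultimately have "norm (s - 1) * norm s * real (Suc n) powr (- Re s - 1) \<le>
          (R + 1) * R * real (Suc n) powr (- (1 + Re z / 2))"
        using ball[OF s] order_trans[OF norm_ge_zero, of s R] by (intro mult_mono) auto
      moreover have "Re s > 0"
        using ball[OF s] z by linarith
      ultimately show "norm (zeta_term (Suc n) s) \<le> (R + 1) * R * real (Suc n) powr (- (1 + Re z / 2))"
        using norm_zeta_term_le[of "Suc n" s] by simp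
    next
      have "summable (\<lambda>n. real (Suc n) powr (- (1 + Re z / 2)))"
        by (subst summable_Suc_iff) (use summable_powr_minus[of "1 + Re z / 2"] z in simp)
      then show "summable (\<lambda>n. (R + 1) * R * real (Suc n) powr (- (1 + Re z / 2)))"
        by (rule summable_mult)
    qed
    moreover have "cball z (Re z / 2) \<subseteq> {s. Re s > 0}"
      using ball z by fastforce
    ultimately show "\<exists>d>0. cball z d \<subseteq> {s. Re s > 0} \<and>
        uniform_limit (cball z d) (\<lambda>N s. \<Sum>n<N. zeta_term (Suc n) s) (\<lambda>s. \<Sum>n. zeta_term (Suc n) s) sequentially"
      using z by (intro exI[of _ "Re z / 2"]) auto
  qed (rule open_halfspace_Re_gt)
  then show ?thesis
    unfolding zeta_reg_def by (intro holomorphic_intros)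
qed

lemma zeta_reg_1: "zeta_reg 1 = 1"
proof -
  have "zeta_term (Suc n) 1 = 0" for n
    by (simp add: zeta_term_def del: of_nat_Suc)
  then show ?thesis
    by (simp add: zeta_reg_def)
qed

definition zeta_series :: "complex \<Rightarrow> complex" where
  "zeta_series s = (\<Sum>n. of_nat n powr - s)"

lemma summable_norm_zeta: "Re s > 1 \<Longrightarrow> summable (\<lambda>n. norm (of_nat n powr - s :: complex))"
  using summable_powr_minus[of "Re s"] by (simp add: norm_of_nat_powr)

lemma zeta_series_sums: "Re s > 1 \<Longrightarrow> (\<lambda>n. of_nat n powr - s) sums zeta_series s"
  unfolding zeta_series_def by (rule summable_sums[OF summable_norm_cancel[OF summable_norm_zeta]])

text \<open>The last two parts of \<open>zeta_term\<close> telescope. The boundary value at 1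
  cancels the leading 1 of \<open>zeta_reg\<close>; the other one tends to 0 because Re s >
  1.\<close>

lemma zeta_reg_eq:
  assumes s: "Re s > 1"
  shows "zeta_reg s = (s - 1) * zeta_series s"
proof -
  have partial: "(\<Sum>n<N. zeta_term (Suc n) s) =
      (s - 1) * (\<Sum>n<N. of_nat (Suc n) powr - s) - 1 + of_nat (Suc N) powr (1 - s)" for N
    by (induction N) (simp_all add: zeta_term_def algebra_simps)
  have "(\<lambda>n. of_nat (Suc n) powr - s) sums zeta_series s"
    by (subst sums_Suc_iff) (use zeta_series_sums[OF s] in simp)
  moreover have "(\<lambda>N. of_nat (Suc N) powr (1 - s) :: complex) \<longlonglongrightarrow> 0"
  proof (rule tendsto_norm_zero_cancel)
    have "(\<lambda>N. real (Suc N) powr (1 - Re s)) \<longlonglongrightarrow> 0"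
      using s by real_asymp
    then show "(\<lambda>N. norm (of_nat (Suc N) powr (1 - s) :: complex)) \<longlonglongrightarrow> 0"
      by (simp add: norm_of_nat_powr del: of_nat_Suc)
  qed
  ultimately have "(\<lambda>N. (s - 1) * (\<Sum>n<N. of_nat (Suc n) powr - s) - 1 + of_nat (Suc N) powr (1 - s))
      \<longlonglongrightarrow> (s - 1) * zeta_series s - 1 + 0"
    unfolding sums_def by (intro tendsto_intros)
  then have "(\<lambda>n. zeta_term (Suc n) s) sums ((s - 1) * zeta_series s - 1)"
    unfolding sums_def partial by simp
  then show ?thesis
    by (simp add: zeta_reg_def sums_iff)
qed

lemma
  assumes s: "Re s > 1"
  shows zeta_series_deriv: "(zeta_series has_field_derivative deriv zeta_series s) (at s)"
    and zeta_series_deriv_sums: "(\<lambda>n. - of_real (ln (real n)) * of_nat n powr - s) sums deriv zeta_series s"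
proof -
  \<comment> \<open>A point strictly between 1 and \<open>Re s\<close> gives an open half-plane
    around \<open>s\<close> with uniform convergence, which permits termwise
    differentiation.\<close>
  define \<sigma> where "\<sigma> = (1 + Re s) / 2"
  have \<sigma>: "1 < \<sigma>" "\<sigma> < Re s"
    using s by (auto simp: \<sigma>_def)
  let ?A = "{z. Re z > \<sigma>}" and ?f = "\<lambda>N z. \<Sum>n<N. of_nat n powr - z :: complex"
  have A: "open ?A" "s \<in> ?A"
    using \<sigma> by (auto simp: open_halfspace_Re_gt)
  have lim: "uniform_limit ?A ?f zeta_series sequentially"
    unfolding zeta_series_def
  proof (rule Weierstrass_m_test)
    fix n and z assume z: "z \<in> ?A"
    show "norm (of_nat n powr - z :: complex) \<le> real n powr - \<sigma>"
    proof (cases "n = 0")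
      case False
      then show ?thesis
        using z by (simp add: norm_of_nat_powr powr_mono)
    qed simp
  qed (use \<sigma> in \<open>simp add: summable_powr_minus\<close>)
  have term': "((\<lambda>z. of_nat n powr - z) has_field_derivative - of_real (ln (real n)) * of_nat n powr - z) (at z)"
    for n and z :: complex
  proof (cases "n = 0")
    case False
    have "((\<lambda>z. exp (- z * of_real (ln (real n)))) has_field_derivative
        - of_real (ln (real n)) * exp (- z * of_real (ln (real n)))) (at z)"
      by (auto intro!: derivative_eq_intros)
    then show ?thesis
      using False by (simp add: powr_def)
  qed simp
  have f': "(?f N has_field_derivative (\<Sum>n<N. - of_real (ln (real n)) * of_nat n powr - z)) (at z)" for N z
    by (intro DERIV_sum term')
  have "?f N holomorphic_on B" for N B
    using f' by (auto simp: holomorphic_on_def field_differentiable_def intro: has_field_derivative_at_within)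
  then have holo: "\<forall>\<^sub>F N in sequentially. ?f N holomorphic_on ?A"
    by simp
  show "(\<lambda>n. - of_real (ln (real n)) * of_nat n powr - s) sums deriv zeta_series s"
    using deriv_complex_uniform_limit[OF lim holo _ A]
    by (simp only: sums_def DERIV_imp_deriv[OF f'] sequentially_bot not_False_eq_True)
  have "zeta_series holomorphic_on ?A"
  proof (rule holomorphic_uniform_sequence[OF A(1)])
    show "?f N holomorphic_on ?A" for N
      by fact
    show "\<exists>d>0. cball z d \<subseteq> ?A \<and> uniform_limit (cball z d) ?f zeta_series sequentially" if "z \<in> ?A" for z
      using A(1) that uniform_limit_on_subset[OF lim] unfolding open_contains_cball by blast
  qed
  then show "(zeta_series has_field_derivative deriv zeta_series s) (at s)"
    using A by (rule holomorphic_derivI)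
qed

text \<open>\<open>k\<close> is the order of the zero at \<open>z\<close>: if
  \<open>f w = g w * (w - z) ^ k\<close> with \<open>g z \<noteq> 0\<close>, then the logarithmic
  derivative is \<open>k / (w - z)\<close> plus the bounded term \<open>g' / g\<close> near
  \<open>z\<close>.\<close>

lemma logderiv_order:
  assumes f: "f holomorphic_on S" and S: "open S" "connected S" "z \<in> S" and nz: "\<exists>w\<in>S. f w \<noteq> 0"
  obtains k :: nat where "k = 0 \<longleftrightarrow> f z \<noteq> 0" "eventually (\<lambda>s. f s \<noteq> 0) (at z)"
    "((\<lambda>s. (s - z) * deriv f s / f s) \<longlongrightarrow> of_nat k) (at z)"
proof -
  define k where "k = nat (zorder f z)"
  define g where "g = zor_poly f z"
  from zorder_exist_zero[OF f S nz] obtain r where r: "r > 0" "g holomorphic_on cball z r"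
    and fg: "\<And>w. w \<in> cball z r \<Longrightarrow> f w = g w * (w - z) ^ k \<and> g w \<noteq> 0"
    and ord: "if f z = 0 then zorder f z > 0 else zorder f z = 0"
    unfolding k_def g_def by blast
  have g: "g holomorphic_on ball z r"
    using r(2) holomorphic_on_subset ball_subset_cball by blast
  have near: "eventually (\<lambda>s. s \<in> ball z r - {z}) (at z)"
    using r(1) eventually_at_in_open[of "ball z r" z] by simp
  have deriv: "(s - z) * deriv f s / f s = (s - z) * deriv g s / g s + of_nat k" if s: "s \<in> ball z r - {z}" for s
  proof -
    have "(g has_field_derivative deriv g s) (at s)"
      using g s by (intro holomorphic_derivI) auto
    then have g': "((\<lambda>w. g w * (w - z) ^ k) has_field_derivative
        deriv g s * (s - z) ^ k + g s * (of_nat k * (s - z) ^ (k - 1))) (at s)"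
      by (auto intro!: derivative_eq_intros)
    have "(f has_field_derivative
        deriv g s * (s - z) ^ k + g s * (of_nat k * (s - z) ^ (k - 1))) (at s)"
      by (rule has_field_derivative_transform_within_open[OF g', where S = "ball z r"]) (use s fg in auto)
    then have d: "deriv f s = deriv g s * (s - z) ^ k + g s * (of_nat k * (s - z) ^ (k - 1))"
      by (rule DERIV_imp_deriv)
    have "s \<noteq> z" "g s \<noteq> 0" and fs: "f s = g s * (s - z) ^ k"
      using s fg[of s] by auto
    \<comment> \<open>For \<open>k = 0\<close> the exponent \<open>k - 1\<close> is truncated, but
      the factor \<open>of_nat k\<close> then vanishes.\<close>
    have k: "(s - z) * (of_nat k * (s - z) ^ (k - 1)) = of_nat k * (s - z) ^ k"
      by (cases k) simp_all
    have "(s - z) * deriv f s =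
        (s - z) * deriv g s * (s - z) ^ k + g s * ((s - z) * (of_nat k * (s - z) ^ (k - 1)))"
      unfolding d by (simp only: distrib_left mult_ac)
    also have "\<dots> = ((s - z) * deriv g s / g s + of_nat k) * f s"
      unfolding k fs using \<open>g s \<noteq> 0\<close> by (simp add: field_simps)
    finally have "(s - z) * deriv f s = ((s - z) * deriv g s / g s + of_nat k) * f s" .
    then show ?thesis
      using \<open>s \<noteq> z\<close> \<open>g s \<noteq> 0\<close> fs by simp
  qed
  show thesis
  proof
    show "k = 0 \<longleftrightarrow> f z \<noteq> 0"
      using ord by (auto simp: k_def split: if_splits)
    show "eventually (\<lambda>s. f s \<noteq> 0) (at z)"
      using near by eventually_elim (use fg in auto)
    have "isCont g z" "isCont (deriv g) z"
      using r(1) holomorphic_on_imp_continuous_on[OF g]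
        holomorphic_on_imp_continuous_on[OF holomorphic_deriv[OF g open_ball]]
      by (auto intro: continuous_on_interior)
    then have "((\<lambda>s. (s - z) * deriv g s / g s + of_nat k) \<longlongrightarrow> (z - z) * deriv g z / g z + of_nat k) (at z)"
      using fg[of z] r(1) unfolding isCont_def by (intro tendsto_intros) auto
    then show "((\<lambda>s. (s - z) * deriv f s / f s) \<longlongrightarrow> of_nat k) (at z)"
      using near by (auto elim!: Lim_transform_eventually eventually_mono simp: deriv)
  qed
qed

section \<open>The Dirichlet series of the von Mangoldt function\<close>

definition mangoldt_series :: "complex \<Rightarrow> complex" where
  "mangoldt_series s = (\<Sum>n. mangoldt n * of_nat n powr - s)"

lemma summable_mangoldt:
  assumes "\<sigma> > 1"
  shows "summable (\<lambda>n. mangoldt n * real n powr - \<sigma>)"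
proof (rule summable_comparison_test')
  \<comment> \<open>Half of the excess \<open>\<sigma> - 1\<close> absorbs the logarithm; the other
    half keeps the exponent above 1.\<close>
  define \<epsilon> where "\<epsilon> = (\<sigma> - 1) / 2"
  have \<epsilon>: "\<epsilon> > 0" "\<sigma> - \<epsilon> > 1"
    using assms by (simp_all add: \<epsilon>_def field_simps)
  show "summable (\<lambda>n. (1 / \<epsilon>) * real n powr - (\<sigma> - \<epsilon>))"
    by (intro summable_mult summable_powr_minus \<epsilon>)
  fix n :: nat
  show "norm (mangoldt n * real n powr - \<sigma>) \<le> (1 / \<epsilon>) * real n powr - (\<sigma> - \<epsilon>)"
  proof (cases "n = 0")
    case False
    have "mangoldt n \<le> ln (real n)"
      using mangoldt_le False by simp
    also have "\<dots> \<le> real n powr \<epsilon> / \<epsilon>"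
      using False \<epsilon> by (intro ln_powr_bound) auto
    finally have "mangoldt n * real n powr - \<sigma> \<le> real n powr \<epsilon> / \<epsilon> * real n powr - \<sigma>"
      by (intro mult_right_mono) auto
    also have "\<dots> = (1 / \<epsilon>) * real n powr - (\<sigma> - \<epsilon>)"
      using False by (simp flip: powr_add)
    finally show ?thesis
      by (simp add: mangoldt_nonneg abs_mult)
  qed simp
qed

lemma norm_mangoldt_powr:
  "norm (mangoldt n * of_nat n powr - s :: complex) = mangoldt n * real n powr - Re s"
  by (simp add: norm_mult norm_of_nat_powr)

lemma mangoldt_series_sums:
  assumes "Re s > 1"
  shows "(\<lambda>n. mangoldt n * of_nat n powr - s) sums mangoldt_series s"
  unfolding mangoldt_series_def
  by (rule summable_sums[OF summable_norm_cancel])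
     (use summable_mangoldt[OF assms] in \<open>simp add: norm_mangoldt_powr\<close>)

lemma norm_mangoldt_series_le:
  assumes "Re s > 1"
  shows "norm (mangoldt_series s) \<le> (\<Sum>n. mangoldt n * real n powr - Re s)"
  unfolding mangoldt_series_def
  using summable_norm[of "\<lambda>n. mangoldt n * of_nat n powr - s"] summable_mangoldt[OF assms]
  by (simp add: norm_mangoldt_powr)

lemma has_sum_product_nat:
  fixes a b :: "nat \<Rightarrow> complex"
  assumes a: "summable (\<lambda>n. norm (a n))" and b: "summable (\<lambda>n. norm (b n))"
  shows "((\<lambda>(d, m). a d * b m) has_sum (suminf a * suminf b)) (UNIV \<times> UNIV)"
proof (rule has_sum_SigmaI)
  have A: "(a has_sum suminf a) UNIV" and B: "(b has_sum suminf b) UNIV"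
    using a b by (auto intro!: norm_summable_imp_has_sum summable_sums dest: summable_norm_cancel)
  show "((\<lambda>d. a d * suminf b) has_sum suminf a * suminf b) UNIV"
    by (rule has_sum_cmult_left[OF A])
  show "((\<lambda>m. case (d, m) of (d, m) \<Rightarrow> a d * b m) has_sum a d * suminf b) UNIV" for d
    using has_sum_cmult_right[OF B] by simp
  have nA: "(\<lambda>d. norm (a d)) summable_on UNIV" and nB: "(\<lambda>m. norm (b m)) summable_on UNIV"
    using a b by (simp_all add: summable_on_UNIV_nonneg_real_iff)
  have "(\<lambda>p. norm (case p of (d, m) \<Rightarrow> a d * b m)) summable_on (UNIV \<times> UNIV)"
    unfolding Infinite_Sum.abs_summable_on_Sigma_iff
    using nA nB by (auto simp: norm_mult abs_mult infsum_cmult_right' intro!: summable_on_cmult_left summable_on_cmult_right)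
  then show "(\<lambda>(d, m). a d * b m) summable_on (UNIV \<times> UNIV)"
    by (rule abs_summable_summable)
qed

text \<open>The sum of the von Mangoldt function over the divisors of \<open>n\<close> is
  \<open>ln n\<close>. Absolute convergence allows regrouping the double sum over
  \<open>(d, m)\<close> by the product \<open>n = d * m\<close>.\<close>

lemma mangoldt_series_times_zeta:
  assumes s: "Re s > 1"
  shows "mangoldt_series s * zeta_series s = - deriv zeta_series s"
proof -
  define a where "a = (\<lambda>n. mangoldt n * of_nat n powr - s)"
  define b :: "nat \<Rightarrow> complex" where "b = (\<lambda>n. of_nat n powr - s)"
  have "summable (\<lambda>n. norm (a n))" "summable (\<lambda>n. norm (b n))"
    using summable_mangoldt[OF s] summable_norm_zeta[OF s] by (simp_all add: a_def b_def norm_mangoldt_powr)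
  then have "((\<lambda>(d, m). a d * b m) has_sum suminf a * suminf b) (UNIV \<times> UNIV)"
    by (rule has_sum_product_nat)
  then have "((\<lambda>(d, m). a d * b m) has_sum mangoldt_series s * zeta_series s) (UNIV \<times> UNIV)"
    by (simp only: mangoldt_series_def zeta_series_def a_def b_def)
  \<comment> \<open>Pairs with a zero coordinate contribute 0. Without them, \<open>(d, m)\<close>
    corresponds bijectively to \<open>n = d * m\<close> with a marked divisor
    \<open>d\<close>.\<close>
  also have "?this \<longleftrightarrow> ((\<lambda>(d, m). a d * b m) has_sum mangoldt_series s * zeta_series s) ({1..} \<times> {1..})"
    by (rule has_sum_cong_neutral) (auto simp: a_def b_def not_less_eq_eq)
  also have "\<dots> \<longleftrightarrow> ((\<lambda>(n, d). mangoldt d * of_nat n powr - s) has_sum mangoldt_series s * zeta_series s)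
      (Sigma {1..} (\<lambda>n. {d. d dvd n}))"
  proof (rule has_sum_reindex_bij_witness[of _ "\<lambda>(n, d). (d, n div d)" "\<lambda>(d, m). (d * m, d)"])
    fix p :: "nat \<times> nat" assume p: "p \<in> {1..} \<times> {1..}"
    then show "(case case p of (d, m) \<Rightarrow> (d * m, d) of (n, d) \<Rightarrow> mangoldt d * of_nat n powr - s) =
        (case p of (d, m) \<Rightarrow> a d * b m)"
      by (auto simp: a_def b_def powr_times_real)
  qed (auto simp: Suc_le_eq dvd_imp_le elim!: dvdE)
  finally have "((\<lambda>n. \<Sum>d | d dvd n. mangoldt d * of_nat n powr - s) has_sum
      mangoldt_series s * zeta_series s) {1..}"
    by (rule has_sum_Sigma') (auto intro!: has_sum_finiteI)
  also have "?this \<longleftrightarrow> ((\<lambda>n. of_real (ln (real n)) * of_nat n powr - s) has_sum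
      mangoldt_series s * zeta_series s) {1..}"
    by (rule has_sum_cong) (simp add: mangoldt_sum flip: sum_distrib_right)
  also have "\<dots> \<longleftrightarrow> ((\<lambda>n. of_real (ln (real n)) * of_nat n powr - s) has_sum
      mangoldt_series s * zeta_series s) UNIV"
    by (rule has_sum_cong_neutral) (auto simp: not_less_eq_eq)
  finally have "(\<lambda>n. of_real (ln (real n)) * of_nat n powr - s) sums (mangoldt_series s * zeta_series s)"
    by (rule has_sum_imp_sums)
  moreover have "(\<lambda>n. of_real (ln (real n)) * of_nat n powr - s) sums (- deriv zeta_series s)"
    using sums_minus[OF zeta_series_deriv_sums[OF s]] by simp
  ultimately show ?thesis
    by (rule sums_unique2)
qed

text \<open>Logarithmic differentiation of \<open>zeta_reg s = (s - 1) * zeta_series s\<close>; the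
  pole of zeta becomes the explicit term \<open>1 / (s - 1)\<close>.\<close>

lemma mangoldt_series_eq:
  assumes s: "Re s > 1" and nz: "zeta_reg s \<noteq> 0"
  shows "mangoldt_series s = 1 / (s - 1) - deriv zeta_reg s / zeta_reg s"
proof -
  have "eventually (\<lambda>z. z \<in> {z. Re z > 1}) (nhds s)"
    using s by (intro eventually_nhds_in_open open_halfspace_Re_gt) auto
  then have "eventually (\<lambda>z. zeta_reg z = (z - 1) * zeta_series z) (nhds s)"
    by eventually_elim (simp add: zeta_reg_eq)
  then have "deriv zeta_reg s = deriv (\<lambda>z. (z - 1) * zeta_series z) s"
    by (rule deriv_cong_ev) simp
  also have "\<dots> = zeta_series s + (s - 1) * deriv zeta_series s"
    by (rule DERIV_imp_deriv) (auto intro!: derivative_eq_intros zeta_series_deriv s)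
  also have "deriv zeta_series s = - (mangoldt_series s * zeta_series s)"
    using mangoldt_series_times_zeta[OF s] by simp
  finally have "deriv zeta_reg s = zeta_series s - mangoldt_series s * zeta_reg s"
    by (simp add: zeta_reg_eq[OF s])
  moreover have "1 / (s - 1) = zeta_series s / zeta_reg s"
    using nz by (simp add: zeta_reg_eq[OF s])
  ultimately show ?thesis
    using nz by (simp add: diff_divide_distrib)
qed

lemma zeta_reg_order:
  assumes "Re z > 0"
  obtains k :: nat where "k = 0 \<longleftrightarrow> zeta_reg z \<noteq> 0" "eventually (\<lambda>s. zeta_reg s \<noteq> 0) (at z)"
    "((\<lambda>s. (s - z) * deriv zeta_reg s / zeta_reg s) \<longlongrightarrow> of_nat k) (at z)"
proof -
  have "connected {s. Re s > 0}"
    by (intro convex_connected convex_halfspace_Re_gt)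
  moreover have "z \<in> {s. Re s > 0}"
    using assms by simp
  moreover have "\<exists>w\<in>{s. Re s > 0}. zeta_reg w \<noteq> 0"
    by (rule bexI[of _ 1]) (simp_all add: zeta_reg_1)
  ultimately show thesis
    by (rule logderiv_order[OF zeta_reg_holomorphic open_halfspace_Re_gt]) (rule that)
qed

section \<open>Non-vanishing of zeta for Re s >= 1\<close>

text \<open>Approaching \<open>z\<close> horizontally from the right stays within Re s > 1. Away
  from 1 the term \<open>1 / (s - 1)\<close> drops out, leaving minus the order of the zero of
  \<open>zeta_reg\<close>.\<close>

lemma mangoldt_series_residue:
  assumes z: "Re z \<ge> 1" "z \<noteq> 1"
  obtains k :: nat where "k = 0 \<longleftrightarrow> zeta_reg z \<noteq> 0"
    "((\<lambda>\<epsilon>. of_real \<epsilon> * mangoldt_series (z + of_real \<epsilon>)) \<longlongrightarrow> - of_nat k) (at_right 0)"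
proof -
  have "Re z > 0"
    using z by simp
  then obtain k :: nat where k: "k = 0 \<longleftrightarrow> zeta_reg z \<noteq> 0" "eventually (\<lambda>s. zeta_reg s \<noteq> 0) (at z)"
    "((\<lambda>s. (s - z) * deriv zeta_reg s / zeta_reg s) \<longlongrightarrow> of_nat k) (at z)"
    by (rule zeta_reg_order)
  have "((\<lambda>\<epsilon>. z + of_real \<epsilon>) \<longlongrightarrow> z + of_real 0) (at_right (0 :: real))"
    by (intro tendsto_intros)
  then have path: "filterlim (\<lambda>\<epsilon>. z + of_real \<epsilon>) (at z) (at_right (0 :: real))"
    unfolding filterlim_at by (auto simp: eventually_at_filter)
  have lim: "((\<lambda>s. (s - z) * (1 / (s - 1)) - (s - z) * deriv zeta_reg s / zeta_reg s) \<longlongrightarrow>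
      (z - z) * (1 / (z - 1)) - of_nat k) (at z)"
    using z by (intro tendsto_intros k) auto
  have "((\<lambda>\<epsilon>. (z + of_real \<epsilon> - z) * (1 / (z + of_real \<epsilon> - 1)) -
      (z + of_real \<epsilon> - z) * deriv zeta_reg (z + of_real \<epsilon>) / zeta_reg (z + of_real \<epsilon>)) \<longlongrightarrow>
      (z - z) * (1 / (z - 1)) - of_nat k) (at_right (0 :: real))"
    by (rule filterlim_compose[OF lim path])
  moreover have "eventually (\<lambda>\<epsilon>. zeta_reg (z + of_real \<epsilon>) \<noteq> 0) (at_right (0 :: real))"
    using k(2) path unfolding filterlim_iff by blast
  then have "eventually (\<lambda>\<epsilon>. (z + of_real \<epsilon> - z) * (1 / (z + of_real \<epsilon> - 1)) -
      (z + of_real \<epsilon> - z) * deriv zeta_reg (z + of_real \<epsilon>) / zeta_reg (z + of_real \<epsilon>) =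
      of_real \<epsilon> * mangoldt_series (z + of_real \<epsilon>)) (at_right (0 :: real))"
    using eventually_at_right_less[of "0 :: real"]
  proof eventually_elim
    case (elim \<epsilon>)
    have "Re (z + of_real \<epsilon>) > 1"
      using z elim by simp
    then show ?case
      using elim by (simp add: mangoldt_series_eq right_diff_distrib)
  qed
  ultimately have "((\<lambda>\<epsilon>. of_real \<epsilon> * mangoldt_series (z + of_real \<epsilon>)) \<longlongrightarrow> - of_nat k) (at_right 0)"
    using Lim_transform_eventually by fastforce
  with k(1) show thesis
    by (rule that)
qed

text \<open>At 1 the pole contributes 1, and the order is 0 because
  \<open>zeta_reg 1 = 1\<close>.\<close>

lemma mangoldt_series_residue_1:
  "((\<lambda>\<epsilon>. of_real \<epsilon> * mangoldt_series (1 + of_real \<epsilon>)) \<longlongrightarrow> 1) (at_right 0)"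
proof -
  have "Re 1 > 0"
    by simp
  then obtain k :: nat where k: "k = 0 \<longleftrightarrow> zeta_reg 1 \<noteq> 0" "eventually (\<lambda>s. zeta_reg s \<noteq> 0) (at 1)"
    "((\<lambda>s. (s - 1) * deriv zeta_reg s / zeta_reg s) \<longlongrightarrow> of_nat k) (at 1)"
    by (rule zeta_reg_order)
  have "((\<lambda>\<epsilon>. 1 + complex_of_real \<epsilon>) \<longlongrightarrow> 1 + of_real 0) (at_right 0)"
    by (intro tendsto_intros)
  then have path: "filterlim (\<lambda>\<epsilon>. 1 + complex_of_real \<epsilon>) (at 1) (at_right 0)"
    unfolding filterlim_at by (auto simp: eventually_at_filter)
  have "((\<lambda>s. 1 - (s - 1) * deriv zeta_reg s / zeta_reg s) \<longlongrightarrow> 1 - of_nat k) (at 1)"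
    by (intro tendsto_intros k)
  then have "((\<lambda>\<epsilon>. 1 - (1 + complex_of_real \<epsilon> - 1) * deriv zeta_reg (1 + of_real \<epsilon>) / zeta_reg (1 + of_real \<epsilon>))
      \<longlongrightarrow> 1 - of_nat k) (at_right 0)"
    by (rule filterlim_compose[OF _ path])
  moreover have "eventually (\<lambda>\<epsilon>. zeta_reg (1 + of_real \<epsilon>) \<noteq> 0) (at_right (0 :: real))"
    using k(2) path unfolding filterlim_iff by blast
  then have "eventually (\<lambda>\<epsilon>. 1 - (1 + complex_of_real \<epsilon> - 1) * deriv zeta_reg (1 + of_real \<epsilon>) / zeta_reg (1 + of_real \<epsilon>) =
      of_real \<epsilon> * mangoldt_series (1 + of_real \<epsilon>)) (at_right 0)"
    using eventually_at_right_less[of "0 :: real"]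
  proof eventually_elim
    case (elim \<epsilon>)
    then show ?case
      by (simp add: mangoldt_series_eq right_diff_distrib)
  qed
  ultimately have "((\<lambda>\<epsilon>. of_real \<epsilon> * mangoldt_series (1 + of_real \<epsilon>)) \<longlongrightarrow> 1 - of_nat k) (at_right 0)"
    using Lim_transform_eventually by fastforce
  then show ?thesis
    using k(1) by (simp add: zeta_reg_1)
qed

text \<open>The 3-4-1 trick: \<open>3 + 4 cos \<theta> + cos 2\<theta> = 2 (1 + cos \<theta>)\<^sup>2\<close>.\<close>

lemma mangoldt_series_341:
  assumes "\<sigma> > 1"
  shows "Re (3 * mangoldt_series \<sigma> + 4 * mangoldt_series (Complex \<sigma> t) + mangoldt_series (Complex \<sigma> (2 * t))) \<ge> 0"
proof -
  have "(\<lambda>n. 3 * (mangoldt n * of_nat n powr - Complex \<sigma> 0) + 4 * (mangoldt n * of_nat n powr - Complex \<sigma> t)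
      + mangoldt n * of_nat n powr - Complex \<sigma> (2 * t)) sums
      (3 * mangoldt_series (Complex \<sigma> 0) + 4 * mangoldt_series (Complex \<sigma> t) + mangoldt_series (Complex \<sigma> (2 * t)))"
    using assms by (intro sums_add sums_mult mangoldt_series_sums) auto
  then have sums: "(\<lambda>n. Re (3 * (mangoldt n * of_nat n powr - Complex \<sigma> 0) + 4 * (mangoldt n * of_nat n powr - Complex \<sigma> t)
      + mangoldt n * of_nat n powr - Complex \<sigma> (2 * t))) sums
      Re (3 * mangoldt_series (Complex \<sigma> 0) + 4 * mangoldt_series (Complex \<sigma> t) + mangoldt_series (Complex \<sigma> (2 * t)))"
    by (rule sums_Re)
  have "0 \<le> Re (3 * (mangoldt n * of_nat n powr - Complex \<sigma> 0) + 4 * (mangoldt n * of_nat n powr - Complex \<sigma> t)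
      + mangoldt n * of_nat n powr - Complex \<sigma> (2 * t))" for n
  proof (cases "n = 0")
    case False
    define \<theta> where "\<theta> = t * ln (real n)"
    have "Re (3 * (mangoldt n * of_nat n powr - Complex \<sigma> 0) + 4 * (mangoldt n * of_nat n powr - Complex \<sigma> t)
        + mangoldt n * of_nat n powr - Complex \<sigma> (2 * t)) =
        mangoldt n * real n powr - \<sigma> * (3 + 4 * cos \<theta> + cos (2 * \<theta>))"
      using False by (simp add: of_nat_powr_Complex \<theta>_def algebra_simps)
    also have "3 + 4 * cos \<theta> + cos (2 * \<theta>) = 2 * (1 + cos \<theta>)\<^sup>2"
      using cos_double_cos[of \<theta>] by (simp add: power2_eq_square algebra_simps)
    finally show ?thesis
      by (simp add: mangoldt_nonneg)
  qed simp
  from sums_le[OF this sums_zero sums] show ?thesis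
    by (simp only: complex_of_real_def)
qed

text \<open>On the line Re z = 1, multiplying the 3-4-1 inequality by \<open>\<epsilon>\<close> and
  letting it tend to 0 gives \<open>3 - 4 * k - l \<ge> 0\<close> for the orders \<open>k\<close>
  and \<open>l\<close> at \<open>1 + it\<close> and \<open>1 + 2it\<close>, which forces
  \<open>k = 0\<close>. To the right of the line, the Mangoldt series stays bounded near
  \<open>z\<close>, so its residue is 0.\<close>

lemma zeta_reg_nonzero:
  assumes "Re z \<ge> 1"
  shows "zeta_reg z \<noteq> 0"
proof (cases "z = 1")
  case False
  obtain k :: nat where k: "k = 0 \<longleftrightarrow> zeta_reg z \<noteq> 0"
    "((\<lambda>\<epsilon>. of_real \<epsilon> * mangoldt_series (z + of_real \<epsilon>)) \<longlongrightarrow> - of_nat k) (at_right 0)"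
    using assms False by (rule mangoldt_series_residue)
  have "k = 0"
  proof (cases "Re z = 1")
    case True
    define t where "t = Im z"
    have z: "z = Complex 1 t"
      using True by (simp add: t_def complex_eq_iff)
    then have "Re (Complex 1 (2 * t)) \<ge> 1" "Complex 1 (2 * t) \<noteq> 1"
      using False by (auto simp: complex_eq_iff)
    then obtain l :: nat where
      l: "((\<lambda>\<epsilon>. of_real \<epsilon> * mangoldt_series (Complex 1 (2 * t) + of_real \<epsilon>)) \<longlongrightarrow> - of_nat l) (at_right 0)"
      by (rule mangoldt_series_residue)
    have "((\<lambda>\<epsilon>. Re (3 * (of_real \<epsilon> * mangoldt_series (1 + of_real \<epsilon>)) +
        4 * (of_real \<epsilon> * mangoldt_series (z + of_real \<epsilon>)) +
        of_real \<epsilon> * mangoldt_series (Complex 1 (2 * t) + of_real \<epsilon>))) \<longlongrightarrow>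
        Re (3 * 1 + 4 * (- of_nat k) + - of_nat l)) (at_right 0)"
      by (intro tendsto_intros mangoldt_series_residue_1 k l)
    moreover have "eventually (\<lambda>\<epsilon>. Re (3 * (of_real \<epsilon> * mangoldt_series (1 + of_real \<epsilon>)) +
        4 * (of_real \<epsilon> * mangoldt_series (z + of_real \<epsilon>)) +
        of_real \<epsilon> * mangoldt_series (Complex 1 (2 * t) + of_real \<epsilon>)) \<ge> 0) (at_right 0)"
      using eventually_at_right_less[of "0 :: real"]
    proof eventually_elim
      case (elim \<epsilon>)
      have eq: "1 + complex_of_real \<epsilon> = of_real (1 + \<epsilon>)" "z + of_real \<epsilon> = Complex (1 + \<epsilon>) t"
        "Complex 1 (2 * t) + of_real \<epsilon> = Complex (1 + \<epsilon>) (2 * t)"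
        by (simp_all add: z complex_eq_iff)
      have "0 \<le> \<epsilon> * Re (3 * mangoldt_series (of_real (1 + \<epsilon>)) + 4 * mangoldt_series (Complex (1 + \<epsilon>) t) +
          mangoldt_series (Complex (1 + \<epsilon>) (2 * t)))"
        using elim by (intro mult_nonneg_nonneg mangoldt_series_341) auto
      then show ?case
        unfolding eq by (simp add: algebra_simps del: of_real_add)
    qed
    ultimately have "0 \<le> Re (3 * 1 + 4 * (- of_nat k) + - of_nat l)"
      by (rule tendsto_lowerbound) simp
    then show ?thesis
      by simp
  next
    case False
    define B where "B = (\<Sum>n. mangoldt n * real n powr - Re z)"
    have z: "Re z > 1"
      using assms False by simp
    have "((\<lambda>\<epsilon>. \<bar>\<epsilon>\<bar> * B) \<longlongrightarrow> \<bar>0\<bar> * B) (at_right 0)"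
      by (intro tendsto_intros)
    moreover have "eventually (\<lambda>\<epsilon>. norm (of_real \<epsilon> * mangoldt_series (z + of_real \<epsilon>)) \<le> \<bar>\<epsilon>\<bar> * B) (at_right 0)"
      using eventually_at_right_less[of "0 :: real"]
    proof eventually_elim
      case (elim \<epsilon>)
      have "norm (mangoldt_series (z + of_real \<epsilon>)) \<le> (\<Sum>n. mangoldt n * real n powr - Re (z + of_real \<epsilon>))"
        using z elim by (intro norm_mangoldt_series_le) simp
      also have "\<dots> \<le> B"
        unfolding B_def
      proof (intro suminf_le summable_mangoldt)
        fix n
        show "mangoldt n * real n powr - Re (z + of_real \<epsilon>) \<le> mangoldt n * real n powr - Re z"
          using elim by (cases "n = 0") (auto intro!: mult_left_mono powr_mono mangoldt_nonneg)
      qed (use z elim in auto)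
      finally show ?case
        by (simp add: norm_mult mult_left_mono)
    qed
    ultimately have "((\<lambda>\<epsilon>. of_real \<epsilon> * mangoldt_series (z + of_real \<epsilon>)) \<longlongrightarrow> 0) (at_right 0)"
      by (auto intro: Lim_null_comparison)
    then have "- of_nat k = (0 :: complex)"
      using k(2) by (intro tendsto_unique[of "at_right (0 :: real)"]) auto
    then show ?thesis
      by simp
  qed
  then show ?thesis
    using k(1) by simp
qed (simp add: zeta_reg_1)

text \<open>Both series have the principal part \<open>1 / (s - 1)\<close> at 1, since
  \<open>zeta_reg 1 = 1\<close>, so it cancels in the difference. What remains is singular only at
  zeros of \<open>zeta_reg\<close>, which \<open>S\<close> excludes.\<close>

lemma mangoldt_minus_one_continuation:
  obtains S G where "open S" "{s. Re s \<ge> 1} \<subseteq> S" "G holomorphic_on S"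
    "\<And>s. Re s > 1 \<Longrightarrow> (\<lambda>n. of_real (mangoldt n - 1) * of_nat n powr - s) sums G s"
proof
  \<comment> \<open>This is zeta minus its principal part at 1: the difference quotient of
    \<open>zeta_reg\<close>, with its removable singularity filled in.\<close>
  define E where "E s = (if s = 1 then deriv zeta_reg 1 else (zeta_reg s - zeta_reg 1) / (s - 1))" for s
  define S where "S = {s. Re s > 0} \<inter> zeta_reg -` (- {0})"
  have cont: "continuous_on {s. Re s > 0} zeta_reg"
    using zeta_reg_holomorphic by (rule holomorphic_on_imp_continuous_on)
  show "open S"
    unfolding S_def by (rule continuous_open_preimage[OF cont open_halfspace_Re_gt]) auto
  show "{s. Re s \<ge> 1} \<subseteq> S"
    using zeta_reg_nonzero by (auto simp: S_def)
  have "E holomorphic_on {s. Re s > 0}"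
    unfolding E_def by (intro pole_lemma_open zeta_reg_holomorphic open_halfspace_Re_gt)
  moreover have "deriv zeta_reg holomorphic_on {s. Re s > 0}"
    by (intro holomorphic_deriv zeta_reg_holomorphic open_halfspace_Re_gt)
  moreover have "S \<subseteq> {s. Re s > 0}"
    by (auto simp: S_def)
  ultimately show "(\<lambda>s. - deriv zeta_reg s / zeta_reg s - E s) holomorphic_on S"
    using zeta_reg_holomorphic
    by (intro holomorphic_on_diff holomorphic_on_divide holomorphic_on_minus)
       (auto simp: S_def elim: holomorphic_on_subset)
  fix s :: complex
  assume s: "Re s > 1"
  then have [simp]: "s \<noteq> 1"
    by auto
  have "(\<lambda>n. mangoldt n * of_nat n powr - s - of_nat n powr - s) sums (mangoldt_series s - zeta_series s)"
    by (intro sums_diff mangoldt_series_sums zeta_series_sums s)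
  also have "mangoldt_series s - zeta_series s = - deriv zeta_reg s / zeta_reg s - E s"
  proof -
    have "zeta_series s = zeta_reg s / (s - 1)"
      using zeta_reg_eq[OF s] by simp
    moreover have "zeta_reg s \<noteq> 0"
      using s by (intro zeta_reg_nonzero) simp
    ultimately show ?thesis
      by (simp add: mangoldt_series_eq[OF s] E_def zeta_reg_1 diff_divide_distrib)
  qed
  finally show "(\<lambda>n. of_real (mangoldt n - 1) * of_nat n powr - s) sums (- deriv zeta_reg s / zeta_reg s - E s)"
    by (simp add: left_diff_distrib)
qed

section \<open>Primes in short intervals\<close>

text \<open>Without primes, only powers \<open>p ^ k\<close> with \<open>k \<ge> 2\<close> carry
  mass. The first two factors bound the number of pairs \<open>(p, k)\<close>, the last one the
  contribution of each. For fixed \<open>\<eta>\<close> the product is of order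
  \<open>y\<^sup>2 * exp (- y / 2)\<close>.\<close>

lemma sum_mangoldt_over_prime_powers_le:
  assumes y: "y > \<eta>" "\<eta> > 0"
    and no_prime: "\<And>p. prime p \<Longrightarrow> \<not> \<bar>y - ln (real p)\<bar> \<le> \<eta>"
  shows "(\<Sum>n | n > 0 \<and> \<bar>y - ln (real n)\<bar> \<le> \<eta>. mangoldt n / real n) \<le>
    (exp ((y + \<eta>) / 2) + 1) * (2 * (y + \<eta>) + 1) * ((y + \<eta>) * exp (\<eta> - y))"
proof -
  define W where "W = {n. n > 0 \<and> \<bar>y - ln (real n)\<bar> \<le> \<eta>}"
  define Q where "Q = {..nat \<lfloor>exp ((y + \<eta>) / 2)\<rfloor>} \<times> {..nat \<lfloor>2 * (y + \<eta>)\<rfloor>}"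
  define P where "P = (\<lambda>(p, k). p ^ k) ` Q"
  define w where "w = (y + \<eta>) * exp (\<eta> - y)"
  have w: "w \<ge> 0"
    using y by (simp add: w_def)
  have "finite P"
    by (simp add: P_def Q_def)
  have W_iff: "n \<in> W \<longleftrightarrow> n > 0 \<and> y - \<eta> \<le> ln (real n) \<and> ln (real n) \<le> y + \<eta>" for n
    by (auto simp: W_def)
  have prime_power: "n \<in> P" if n: "n \<in> W" "mangoldt n \<noteq> (0 :: real)" for n
  proof -
    have "primepow n"
      using n(2) by (auto simp: mangoldt_def split: if_splits)
    then obtain p k where pk: "prime p" "k > 0" "n = p ^ k"
      unfolding primepow_def by auto
    have p: "p \<ge> 2"
      using pk(1) by (rule prime_ge_2_nat)
    have ln_n: "ln (real n) = real k * ln (real p)"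
      using p by (simp add: pk(3) ln_realpow)
    have le: "real k * ln (real p) \<le> y + \<eta>"
      using n(1) ln_n by (simp add: W_iff)
    have "k \<noteq> 1"
      using no_prime[OF pk(1)] n(1) pk(3) by (auto simp: W_def)
    then have "2 * ln (real p) \<le> real k * ln (real p)"
      using pk(2) p by (intro mult_right_mono) auto
    then have "ln (real p) \<le> (y + \<eta>) / 2"
      using le by simp
    then have "real p \<le> exp ((y + \<eta>) / 2)"
      using p exp_le_cancel_iff[of "ln (real p)"] by simp
    \<comment> \<open>A crude lower bound for \<open>ln p\<close>, responsible for the factor 2 in
      the range of exponents.\<close>
    moreover have "1 / 2 \<le> ln (real p)"
      using p ln2_ge_two_thirds ln_mono[of 2 "real p"] by linarith
    then have "real k * (1 / 2) \<le> real k * ln (real p)"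
      by (rule mult_left_mono) simp
    then have "real k \<le> 2 * (y + \<eta>)"
      using le by simp
    ultimately have "(p, k) \<in> Q"
      by (auto simp: Q_def intro: le_nat_floor)
    then show ?thesis
      unfolding P_def pk(3) by force
  qed
  have "(\<Sum>n\<in>W. mangoldt n / real n) \<le> (\<Sum>n\<in>P. w)"
  proof -
    have "finite W"
      unfolding W_def by (rule finite_log_window)
    then have "(\<Sum>n\<in>W. mangoldt n / real n) = (\<Sum>n\<in>W \<inter> P. mangoldt n / real n)"
      using prime_power by (intro sum.mono_neutral_right) auto
    also have "\<dots> \<le> (\<Sum>n\<in>W \<inter> P. w)"
    proof (rule sum_mono)
      fix n assume "n \<in> W \<inter> P"
      then have n: "n > 0" "y - \<eta> \<le> ln (real n)" "ln (real n) \<le> y + \<eta>"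
        by (auto simp: W_iff)
      have "mangoldt n \<le> y + \<eta>"
        using mangoldt_le[OF n(1)] n(3) by linarith
      moreover have "exp (y - \<eta>) \<le> real n"
        using n exp_le_cancel_iff[of "y - \<eta>" "ln (real n)"] by simp
      then have "1 / real n \<le> 1 / exp (y - \<eta>)"
        using n(1) by (intro divide_left_mono) auto
      then have "1 / real n \<le> exp (\<eta> - y)"
        using exp_minus[of "y - \<eta>"] by (simp add: inverse_eq_divide)
      ultimately have "mangoldt n * (1 / real n) \<le> w"
        unfolding w_def using y by (intro mult_mono) (auto simp: mangoldt_nonneg)
      then show "mangoldt n / real n \<le> w"
        by simp
    qed
    also have "\<dots> \<le> (\<Sum>n\<in>P. w)"
      using \<open>finite P\<close> w by (intro sum_mono2) auto
    finally show ?thesis .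
  qed
  also have "\<dots> = real (card P) * w"
    by simp
  also have "\<dots> \<le> (exp ((y + \<eta>) / 2) + 1) * (2 * (y + \<eta>) + 1) * w"
  proof (rule mult_right_mono[OF _ w])
    have "card P \<le> card Q"
      unfolding P_def by (rule card_image_le) (simp add: Q_def)
    also have "card Q = Suc (nat \<lfloor>exp ((y + \<eta>) / 2)\<rfloor>) * Suc (nat \<lfloor>2 * (y + \<eta>)\<rfloor>)"
      by (simp add: Q_def)
    finally have "real (card P) \<le> real (Suc (nat \<lfloor>exp ((y + \<eta>) / 2)\<rfloor>)) * real (Suc (nat \<lfloor>2 * (y + \<eta>)\<rfloor>))"
      by (simp only: of_nat_le_iff flip: of_nat_mult)
    also have "\<dots> \<le> (exp ((y + \<eta>) / 2) + 1) * (2 * (y + \<eta>) + 1)"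
      using y by (intro mult_mono) (auto simp: of_nat_nat)
    finally show "real (card P) \<le> (exp ((y + \<eta>) / 2) + 1) * (2 * (y + \<eta>) + 1)" .
  qed
  finally show ?thesis
    by (simp add: W_def w_def)
qed

lemma eventually_prime_in_log_window:
  fixes \<eta> :: real
  assumes "\<eta> > 0"
  shows "eventually (\<lambda>y. \<exists>p. prime p \<and> \<bar>y - ln (real p)\<bar> \<le> \<eta>) at_top"
proof -
  obtain S G where SG: "open S" "{s. Re s \<ge> 1} \<subseteq> S" "G holomorphic_on S"
    "\<And>s. Re s > 1 \<Longrightarrow> (\<lambda>n. of_real (mangoldt n - 1) * of_nat n powr - s) sums G s"
    using mangoldt_minus_one_continuation by blast
  obtain c where c: "c > 0"
    "eventually (\<lambda>y. c \<le> (\<Sum>n | n > 0 \<and> \<bar>y - ln (real n)\<bar> \<le> \<eta>. mangoldt n / real n)) at_top"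
    by (rule window_mass_lower_bound[OF mangoldt_nonneg summable_mangoldt SG assms])
  have "((\<lambda>y. (exp ((y + \<eta>) / 2) + 1) * (2 * (y + \<eta>) + 1) * ((y + \<eta>) * exp (\<eta> - y))) \<longlongrightarrow> 0) at_top"
    by real_asymp
  then have "eventually (\<lambda>y. (exp ((y + \<eta>) / 2) + 1) * (2 * (y + \<eta>) + 1) * ((y + \<eta>) * exp (\<eta> - y)) < c) at_top"
    using c(1) by (rule order_tendstoD)
  with c(2) eventually_gt_at_top[of \<eta>] show ?thesis
  proof eventually_elim
    case (elim y)
    show ?case
    proof (rule ccontr)
      assume "\<not> ?case"
      then have "\<And>p. prime p \<Longrightarrow> \<not> \<bar>y - ln (real p)\<bar> \<le> \<eta>"
        by blast
      from sum_mangoldt_over_prime_powers_le[OF elim(2) assms this] show False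
        using elim by linarith
    qed
  qed
qed

lemma eventually_prime_between:
  fixes r :: real
  assumes "r > 1"
  shows "eventually (\<lambda>x. \<exists>p. prime p \<and> x < real p \<and> real p \<le> r * x) at_top"
proof -
  \<comment> \<open>The window of radius \<open>\<eta>\<close> about
    \<open>ln x + 3 * \<eta> / 2\<close> lies between \<open>ln x\<close> and
    \<open>ln x + 3 * \<eta> = ln (r * x)\<close>, with a margin of \<open>\<eta> / 2\<close> on
    both sides that yields the strict inequality.\<close>
  define \<eta> where "\<eta> = ln r / 3"
  have \<eta>: "\<eta> > 0"
    using assms by (simp add: \<eta>_def)
  have "filterlim (\<lambda>x. ln x + 3 * \<eta> / 2) at_top at_top"
    by real_asymp
  then have "eventually (\<lambda>x. \<exists>p. prime p \<and> \<bar>ln x + 3 * \<eta> / 2 - ln (real p)\<bar> \<le> \<eta>) at_top"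
    using eventually_prime_in_log_window[OF \<eta>] unfolding filterlim_iff by blast
  with eventually_gt_at_top[of "0 :: real"] show ?thesis
  proof eventually_elim
    case (elim x)
    then obtain p where p: "prime p" and "\<bar>ln x + 3 * \<eta> / 2 - ln (real p)\<bar> \<le> \<eta>"
      by blast
    then have "ln x < ln (real p)" "ln (real p) \<le> ln x + ln r"
      using \<eta> unfolding \<eta>_def by linarith+
    moreover have "real p > 0"
      using p by (simp add: prime_gt_0_nat)
    moreover have "ln (r * x) = ln x + ln r"
      using elim(1) assms by (simp add: ln_mult)
    ultimately have "x < real p" "real p \<le> r * x"
      using elim(1) assms ln_le_cancel_iff[of "real p" "r * x"] by simp_all
    with p show ?case
      by blast
  qed
qed

section \<open>Ratios of nearby primes and the final comparison\<close>

lemma nth_prime_mono: "1 \<le> m \<Longrightarrow> m \<le> n \<Longrightarrow> nth_prime m \<le> nth_prime n"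
  using strict_mono_on_leD[OF strict_mono_on_nth_prime, of m n] by simp

lemma nth_prime_Suc_le:
  assumes "n \<ge> 1" "prime q" "nth_prime n < q"
  shows "nth_prime (Suc n) \<le> q"
proof -
  have "q \<in> nth_prime ` {1..}"
    unfolding nth_prime_image using assms(2) by simp
  then obtain m where m: "q = nth_prime m" "m \<ge> 1"
    by auto
  have "n < m"
    using nth_prime_mono[of m n] assms(3) m by (cases "n < m") auto
  then show ?thesis
    unfolding m(1) by (intro nth_prime_mono) auto
qed

lemma eventually_nth_prime_Suc_le:
  fixes r :: real
  assumes "r > 1"
  shows "eventually (\<lambda>n. real (nth_prime (Suc n)) \<le> r * real (nth_prime n)) at_top"
proof -
  have "real n - 1 \<le> real (nth_prime n)" for n
    using le_enumerate[OF primes_infinite, of "n - 1"] by (simp add: nth_prime_def)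
  then have "\<forall>\<^sub>F n in at_top. real n - 1 \<le> real (nth_prime n)"
    by simp
  moreover have "filterlim (\<lambda>n. real n - 1) at_top at_top"
    by real_asymp
  ultimately have "filterlim (\<lambda>n. real (nth_prime n)) at_top at_top"
    by (rule filterlim_at_top_mono[rotated])
  then have "eventually (\<lambda>n. \<exists>p. prime p \<and> real (nth_prime n) < real p \<and> real p \<le> r * real (nth_prime n)) at_top"
    using eventually_prime_between[OF assms] unfolding filterlim_iff by blast
  with eventually_ge_at_top[of 1] show ?thesis
  proof eventually_elim
    case (elim n)
    then obtain p where "prime p" "nth_prime n < p" "real p \<le> r * real (nth_prime n)"
      by auto
    moreover from this have "real (nth_prime (Suc n)) \<le> real p"
      using nth_prime_Suc_le[of n p] elim by simp
    ultimately show ?case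
      by linarith
  qed
qed

lemma eventually_nth_prime_add_le:
  fixes r :: real
  assumes "r > 1"
  shows "eventually (\<lambda>n. real (nth_prime (n + k)) \<le> r ^ k * real (nth_prime n)) at_top"
proof (induction k)
  case (Suc k)
  have "eventually (\<lambda>n. real (nth_prime (Suc (n + k))) \<le> r * real (nth_prime (n + k))) at_top"
    using eventually_nth_prime_Suc_le[OF assms] by (rule eventually_all_ge_at_top[THEN eventually_mono]) auto
  with Suc show ?case
  proof eventually_elim
    case (elim n)
    note elim(2)
    also have "r * real (nth_prime (n + k)) \<le> r * (r ^ k * real (nth_prime n))"
      using elim(1) assms by (intro mult_left_mono) auto
    finally show ?case
      by (simp add: mult.assoc)
  qed
qed simp

theorem theorem1:
  fixes g h :: nat and c d :: "nat \<Rightarrow> nat"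
  assumes "g > 1"
    and "1 \<le> h" and "h < g"
    and "\<And>j. j \<in> {1..h} \<Longrightarrow> d j > 0"
  shows "\<exists>N>0. \<forall>n\<ge>N.
    (\<forall>i\<in>{1..g}. n - c i \<ge> 1) \<and>
    (\<Sum>i=1..g. nth_prime (n - c i)) > (\<Sum>j=1..h. nth_prime (n + d j))"
proof -
  define C where "C = Max (c ` {1..g})"
  define D where "D = Max (d ` {1..h})"
  \<comment> \<open>The distance from the smallest index on the left, \<open>n - C\<close>, to the
    largest on the right, \<open>n + D\<close>.\<close>
  define k where "k = C + D"
  have C: "c i \<le> C" if "i \<in> {1..g}" for i
    using that by (simp add: C_def)
  have D: "d j \<le> D" if "j \<in> {1..h}" for j
    using that by (simp add: D_def)
  have "D > 0"
    using assms(2) assms(4)[of 1] D[of 1] by simp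
  then have k: "k > 0"
    by (simp add: k_def)
  \<comment> \<open>Chosen so that \<open>h * r ^ k = h + 1 / 2\<close>, which is below
    \<open>g\<close> because \<open>h < g\<close> are integers. Taking the \<open>k\<close>-th root
    uses \<open>k > 0\<close>.\<close>
  define r where "r = root k (1 + 1 / (2 * real h))"
  have r: "r > 1" "r ^ k = 1 + 1 / (2 * real h)"
    using k assms(2) by (simp_all add: r_def)
  obtain M where M: "\<And>n. n \<ge> M \<Longrightarrow> real (nth_prime (n + k)) \<le> r ^ k * real (nth_prime n)"
    using eventually_nth_prime_add_le[OF r(1), of k] unfolding eventually_at_top_linorder by blast
  show ?thesis
  \<comment> \<open>With this \<open>N\<close> the index \<open>n - C\<close> is at least
    \<open>M\<close>, where the ratio bound starts, and at least 1, so no subtraction is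
    truncated.\<close>
  proof (intro exI[of _ "M + C + 1"] conjI allI impI)
    fix n assume n: "n \<ge> M + C + 1"
    show idx: "\<forall>i\<in>{1..g}. n - c i \<ge> 1"
      using C n by fastforce
    define P where "P = nth_prime (n - C)"
    have "P > 0"
      unfolding P_def using prime_nth_prime by (rule prime_gt_0_nat)
    have "real (\<Sum>j=1..h. nth_prime (n + d j)) \<le> (\<Sum>j=1..h. r ^ k * real P)"
      unfolding of_nat_sum
    proof (rule sum_mono)
      fix j assume j: "j \<in> {1..h}"
      have "nth_prime (n + d j) \<le> nth_prime (n - C + k)"
        using D[OF j] n by (intro nth_prime_mono) (auto simp: k_def)
      then have "real (nth_prime (n + d j)) \<le> real (nth_prime (n - C + k))"
        by simp
      also have "\<dots> \<le> r ^ k * real P"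
        unfolding P_def using n by (intro M) simp
      finally show "real (nth_prime (n + d j)) \<le> r ^ k * real P" .
    qed
    also have "\<dots> = (real h + 1 / 2) * real P"
      using assms(2) by (simp add: r(2) field_simps)
    also have "\<dots> < real g * real P"
      using \<open>P > 0\<close> assms(3) by (intro mult_strict_right_mono) auto
    also have "real g * real P = real (\<Sum>i=1..g. P)"
      by simp
    also have "(\<Sum>i=1..g. P) \<le> (\<Sum>i=1..g. nth_prime (n - c i))"
      unfolding P_def using C n by (intro sum_mono nth_prime_mono diff_le_mono2) auto
    finally show "(\<Sum>i=1..g. nth_prime (n - c i)) > (\<Sum>j=1..h. nth_prime (n + d j))"
      by (simp only: of_nat_less_iff of_nat_le_iff)
  qed simp
qed

end
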